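(* There exists an absolute constant $c>0$ such that for every integer $d\ge 2$ and every origin-symmetric convex body $K\subset\mathbb{R}^d$, there exists a nonzero vector $\mathbf{y}\in\mathbb{Z}^d$ such that $$\frac{|K\cap\mathbb{Z}^d\cap\mathbf{y}^\perp|}{|K\cap\mathbb{Z}^d|}\ \ge\ \min\bigl(1,\ c\cdot d^{-1}\cdot \mathrm{vol}(K)^{-1/(d-1)}\bigr).$$
   Context: A convex body in $\mathbb{R}^d$ is a compact convex set with nonempty interior; it is origin-symmetric if $K=-K$. $\mathrm{vol}(K)$ is the $d$-dimensional Lebesgue volume of $K$. For a nonzero $\mathbf{y}\in\mathbb{R}^d$, $\mathbf{y}^\perp=\{\mathbf{x}\in\mathbb{R}^d : \langle \mathbf{x},\mathbf{y}\rangle=0\}$ is the subspace orthogonal to $\mathbf{y}$. For a finite set $A$, $|A|$ denotes its cardinality. The constant $c$ does not depend on $d$ or $K$. *)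

theory Defs
  imports "HOL-Analysis.Analysis"
begin

text \<open>
  The constant in the theorem must be chosen before the dimension, so the dimension has to be a
  natural number and not a type. Vectors of dimension d are functions on the index set
  \<open>{..<d}\<close>, extensional (equal to \<open>undefined\<close>) outside it. This is the point set
  of both the library's product topology and its product measure, which on \<open>{..<d}\<close> are
  the usual topology and Borel-Lebesgue measure; compact sets are Borel, so nothing is lost
  by not completing the measure.
\<close>

definition Rd :: "nat \<Rightarrow> (nat \<Rightarrow> real) set" where
  "Rd d = (\<Pi>\<^sub>E i\<in>{..<d}. UNIV)"

definition Zd :: "nat \<Rightarrow> (nat \<Rightarrow> real) set" where
  "Zd d = (\<Pi>\<^sub>E i\<in>{..<d}. \<int>)"

definition zero_vector :: "nat \<Rightarrow> nat \<Rightarrow> real" where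
  "zero_vector d = (\<lambda>i\<in>{..<d}. 0)"

definition Rd_topology :: "nat \<Rightarrow> (nat \<Rightarrow> real) topology" where
  "Rd_topology d = product_topology (\<lambda>_. euclideanreal) {..<d}"

definition vol :: "nat \<Rightarrow> (nat \<Rightarrow> real) set \<Rightarrow> real" where
  "vol d K = measure (\<Pi>\<^sub>M i\<in>{..<d}. lborel) K"

definition convex_in :: "nat \<Rightarrow> (nat \<Rightarrow> real) set \<Rightarrow> bool" where
  "convex_in d K \<longleftrightarrow>
     (\<forall>x\<in>K. \<forall>y\<in>K. \<forall>u\<ge>0. \<forall>v\<ge>0. u + v = 1 \<longrightarrow>
        (\<lambda>i\<in>{..<d}. u * x i + v * y i) \<in> K)"

text \<open>\<open>compactin\<close> includes that K is a subset of \<open>Rd d\<close>.\<close>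

definition convex_body :: "nat \<Rightarrow> (nat \<Rightarrow> real) set \<Rightarrow> bool" where
  "convex_body d K \<longleftrightarrow>
     compactin (Rd_topology d) K \<and> convex_in d K \<and> Rd_topology d interior_of K \<noteq> {}"

definition origin_symmetric :: "nat \<Rightarrow> (nat \<Rightarrow> real) set \<Rightarrow> bool" where
  "origin_symmetric d K \<longleftrightarrow> K = (\<lambda>x. \<lambda>i\<in>{..<d}. - x i) ` K"

definition perp :: "nat \<Rightarrow> (nat \<Rightarrow> real) \<Rightarrow> (nat \<Rightarrow> real) set" where
  "perp d y = {x \<in> Rd d. (\<Sum>i<d. x i * y i) = 0}"

end

theory Submission
  imports Defs
begin

text \<open>
  Choose \<open>y\<close> as a difference of two elements of a set \<open>U\<close> of integer vectors. If for all
  \<open>u, v\<close> in \<open>U\<close> the mean of \<open>\<langle>u - v, w\<rangle>\<^sup>2\<close> over the lattice points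
  \<open>w\<close> of \<open>K\<close> is at most \<open>r\<^sup>2\<close>, then for most \<open>w\<close> the values
  \<open>\<langle>u, w\<rangle>\<close> fall into \<open>O(r)\<close> integers, so by Cauchy--Schwarz a
  fraction of order \<open>1/r\<close> of all triples satisfies \<open>\<langle>u, w\<rangle> = \<langle>v, w\<rangle>\<close>.
  Once \<open>U\<close> has more than a constant times \<open>r\<close> elements, the diagonal \<open>u = v\<close>
  is negligible and some \<open>y = u - v \<noteq> 0\<close> is orthogonal to that fraction of the lattice points.

  A large \<open>U\<close> is found by pigeonhole in a translate of a box inside the dual inertia ellipsoid
  of the lattice points. Since \<open>K\<close> contains the inertia ellipsoid itself, the covolumes match:
  \<open>|U| \<ge> (r/d)\<^sup>d / vol K\<close>, which is at least of order \<open>r\<close> for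
  \<open>r\<close> of order \<open>d * vol K powr (1/(d-1))\<close>. This replaces the reverse Santalo inequality.
  The argument needs \<open>r \<ge> 1\<close>, that is \<open>vol K \<ge> (c/d)\<^sup>d\<close>, which holds
  unless all lattice points of \<open>K\<close> lie in one hyperplane.
\<close>

subsection \<open>Counting\<close>

text \<open>Chebyshev around a fixed \<open>v0\<close> puts three quarters of the pairs
  \<open>(u, w)\<close> into a window of O(r) values. Cauchy-Schwarz over the cells
  \<open>(w, k)\<close> turns this mass into coincidences \<open>X u w = X v w\<close>, too many to
  come from the diagonal alone.\<close>

lemma collision:
  fixes X :: "'u \<Rightarrow> 'w \<Rightarrow> int" and r :: real
  assumes fA: "finite A" "A \<noteq> {}" and fU: "finite U" and r: "r \<ge> 1"
    and close: "\<And>u v. u \<in> U \<Longrightarrow> v \<in> U \<Longrightarrow>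
      (\<Sum>w\<in>A. (real_of_int (X u w - X v w))\<^sup>2) \<le> card A * r\<^sup>2"
    and U: "card U \<ge> 20 * r"
  obtains u v where "u \<in> U" "v \<in> U" "u \<noteq> v" "card {w\<in>A. X u w = X v w} \<ge> card A / (20 * r)"
proof -
  note conclude = that
  define M where "M = real (card U)"
  define N where "N = real (card A)"
  have M: "M \<ge> 20 * r" and N: "N > 0" using U fA by (auto simp: M_def N_def card_gt_0_iff)
  have "M > 0" using M r by linarith
  then obtain v0 where v0: "v0 \<in> U" using fU by (auto simp: M_def card_gt_0_iff)
  \<comment> \<open>Two root-mean-square deviations: Chebyshev then loses at most 1/4, and since
    \<open>r \<ge> 1\<close> the window has at most 4r + 1 <= 5r integers.\<close>
  define R where "R = \<lfloor>2 * r\<rfloor>"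
  define I where "I = {-R..R}"
  have R: "0 \<le> R" "real_of_int R \<le> 2 * r" using r unfolding R_def by linarith+
  have cI: "real (card I) \<le> 5 * r" "real (card I) > 0" using R r unfolding I_def by auto
  define n where "n = (\<lambda>w k. real (card {u\<in>U. X u w - X v0 w = k}))"
  have n_alt: "n w k = (\<Sum>u\<in>U. of_bool (X u w - X v0 w = k))" for w k
    unfolding n_def using fU by (simp add: sum.If_cases of_bool_def Int_def conj_commute)
  have fI: "finite I" by (simp add: I_def)
  have I_mass: "(\<Sum>k\<in>I. n w k) = (\<Sum>u\<in>U. of_bool (X u w - X v0 w \<in> I))" for w
  proof -
    have "(\<Sum>k\<in>I. n w k) = (\<Sum>u\<in>U. \<Sum>k\<in>I. of_bool (X u w - X v0 w = k))"
      unfolding n_alt by (rule sum.swap)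
    also have "\<dots> = (\<Sum>u\<in>U. of_bool (X u w - X v0 w \<in> I))"
      using fI by (intro sum.cong refl) (simp add: of_bool_def)
    finally show ?thesis .
  qed
  have cheb: "of_bool (X u w - X v0 w \<in> I) \<ge> 1 - (real_of_int (X u w - X v0 w))\<^sup>2 / (4 * r\<^sup>2)" for u w
  proof (cases "X u w - X v0 w \<in> I")
    case False
    then have "\<bar>X u w - X v0 w\<bar> > R" unfolding I_def by auto
    then have "\<bar>real_of_int (X u w - X v0 w)\<bar> \<ge> 2 * r" unfolding R_def by linarith
    then have "(2 * r)\<^sup>2 \<le> (real_of_int (X u w - X v0 w))\<^sup>2"
      using r by (metis abs_le_square_iff abs_of_nonneg dual_order.trans zero_le_mult_iff zero_le_numeral zero_le_one)
    then show ?thesis using False r by (simp add: field_simps)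
  qed auto
  have mass: "(\<Sum>w\<in>A. \<Sum>k\<in>I. n w k) \<ge> 3/4 * N * M"
  proof -
    have "(\<Sum>w\<in>A. \<Sum>k\<in>I. n w k) = (\<Sum>u\<in>U. \<Sum>w\<in>A. of_bool (X u w - X v0 w \<in> I))"
      unfolding I_mass by (rule sum.swap)
    also have "\<dots> \<ge> (\<Sum>u\<in>U. \<Sum>w\<in>A. 1 - (real_of_int (X u w - X v0 w))\<^sup>2 / (4 * r\<^sup>2))"
      by (intro sum_mono cheb)
    moreover have "(\<Sum>w\<in>A. 1 - (real_of_int (X u w - X v0 w))\<^sup>2 / (4 * r\<^sup>2)) \<ge> 3/4 * N"
      if "u \<in> U" for u
    proof -
      have "(\<Sum>w\<in>A. 1 - (real_of_int (X u w - X v0 w))\<^sup>2 / (4 * r\<^sup>2))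
          = N - (\<Sum>w\<in>A. (real_of_int (X u w - X v0 w))\<^sup>2) / (4 * r\<^sup>2)"
        by (simp add: sum_subtractf sum_divide_distrib N_def)
      also have "\<dots> \<ge> N - (N * r\<^sup>2) / (4 * r\<^sup>2)"
        using close[OF that v0] r unfolding N_def by (intro diff_left_mono divide_right_mono) auto
      finally show ?thesis using r by simp
    qed
    ultimately show ?thesis
      using sum_mono[of U "\<lambda>_. 3/4 * N" "\<lambda>u. \<Sum>w\<in>A. 1 - (real_of_int (X u w - X v0 w))\<^sup>2 / (4 * r\<^sup>2)"]
      by (simp add: M_def mult.commute)
  qed
  have "(\<Sum>(w,k)\<in>A\<times>I. n w k)\<^sup>2 \<le> real (card (A \<times> I)) * (\<Sum>(w,k)\<in>A\<times>I. (n w k)\<^sup>2)"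
    using sum_squared_le_sum_of_squares[of "\<lambda>(w,k). n w k" "A \<times> I"]
    by (simp add: case_prod_unfold mult.commute)
  then have cs: "(\<Sum>w\<in>A. \<Sum>k\<in>I. n w k)\<^sup>2 \<le> N * card I * (\<Sum>w\<in>A. \<Sum>k\<in>I. (n w k)\<^sup>2)"
    by (simp add: sum.cartesian_product card_cartesian_product N_def)
  \<comment> \<open>The square of \<open>n w k\<close> counts ordered pairs \<open>(u, v)\<close>
    whose shifted values both equal \<open>k\<close>; each pair is counted for at most one
    \<open>k\<close>.\<close>
  have sq: "(\<Sum>k\<in>I. (n w k)\<^sup>2) \<le> (\<Sum>u\<in>U. \<Sum>v\<in>U. of_bool (X u w = X v w))" for w
  proof -
    have "(\<Sum>k\<in>I. (n w k)\<^sup>2) = (\<Sum>k\<in>I. \<Sum>u\<in>U. \<Sum>v\<in>U. of_bool (X u w - X v0 w = k) * of_bool (X v w - X v0 w = k))"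
      unfolding power2_eq_square n_alt by (simp only: sum_product)
    also have "\<dots> = (\<Sum>u\<in>U. \<Sum>k\<in>I. \<Sum>v\<in>U. of_bool (X u w - X v0 w = k) * of_bool (X v w - X v0 w = k))"
      by (rule sum.swap)
    also have "\<dots> = (\<Sum>u\<in>U. \<Sum>v\<in>U. \<Sum>k\<in>I. of_bool (X u w - X v0 w = k) * of_bool (X v w - X v0 w = k))"
      by (intro sum.cong refl sum.swap)
    also have "\<dots> \<le> (\<Sum>u\<in>U. \<Sum>v\<in>U. of_bool (X u w = X v w))"
    proof (intro sum_mono)
      fix u v
      have "(\<Sum>k\<in>I. of_bool (X u w - X v0 w = k) * of_bool (X v w - X v0 w = k)::real)
          = (\<Sum>k\<in>I. if X u w - X v0 w = k then of_bool (X v w - X v0 w = k) else 0)"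
        by (intro sum.cong) auto
      also have "\<dots> \<le> of_bool (X u w = X v w)"
        using fI by simp
      finally show "(\<Sum>k\<in>I. of_bool (X u w - X v0 w = k) * of_bool (X v w - X v0 w = k)::real) \<le> of_bool (X u w = X v w)" .
    qed
    finally show ?thesis .
  qed
  define T where "T = (\<lambda>u v. real (card {w\<in>A. X u w = X v w}))"
  have T_alt: "T u v = (\<Sum>w\<in>A. of_bool (X u w = X v w))" for u v
    unfolding T_def using fA by (simp add: sum.If_cases of_bool_def Int_def conj_commute)
  have sum_T: "(\<Sum>w\<in>A. \<Sum>k\<in>I. (n w k)\<^sup>2) \<le> (\<Sum>u\<in>U. \<Sum>v\<in>U. T u v)"
  proof -
    have "(\<Sum>w\<in>A. \<Sum>k\<in>I. (n w k)\<^sup>2) \<le> (\<Sum>w\<in>A. \<Sum>u\<in>U. \<Sum>v\<in>U. of_bool (X u w = X v w))"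
      by (intro sum_mono sq)
    also have "\<dots> = (\<Sum>u\<in>U. \<Sum>w\<in>A. \<Sum>v\<in>U. of_bool (X u w = X v w))" by (rule sum.swap)
    also have "\<dots> = (\<Sum>u\<in>U. \<Sum>v\<in>U. T u v)" unfolding T_alt by (intro sum.cong refl sum.swap)
    finally show ?thesis .
  qed
  have "(3/4 * N * M)\<^sup>2 \<le> (\<Sum>w\<in>A. \<Sum>k\<in>I. n w k)\<^sup>2"
    using mass N \<open>M > 0\<close> by (intro power_mono) auto
  also note cs
  also have "N * card I * (\<Sum>w\<in>A. \<Sum>k\<in>I. (n w k)\<^sup>2) \<le> N * (5 * r) * (\<Sum>u\<in>U. \<Sum>v\<in>U. T u v)"
    using sum_T cI N by (intro mult_mono) (auto intro!: sum_nonneg)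
  finally have low: "9/16 * N * M\<^sup>2 \<le> 5 * r * (\<Sum>u\<in>U. \<Sum>v\<in>U. T u v)"
    using N by (simp add: power2_eq_square algebra_simps)
  \<comment> \<open>If no pair works, then in \<open>low\<close> the off-diagonal terms give at most
    1/4 of \<open>N * M\<^sup>2\<close>, and the diagonal, by \<open>M \<ge> 20 * r\<close>, at most
    another 1/4. Together they fall short of 9/16.\<close>
  show ?thesis
  proof (rule ccontr)
    assume neg: "\<not> thesis"
    have "T u v \<le> N / (20 * r) + of_bool (u = v) * N" if "u \<in> U" "v \<in> U" for u v
    proof (cases "u = v")
      case True
      have "T u v \<le> N" unfolding T_def N_def using fA by (simp add: card_mono)
      moreover have "N / (20 * r) \<ge> 0" using N r by simp
      ultimately show ?thesis using True by simp
    next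
      case False
      then have "T u v < N / (20 * r)"
        using neg conclude[of u v] \<open>u \<in> U\<close> \<open>v \<in> U\<close> unfolding T_def N_def by fastforce
      then show ?thesis using False by simp
    qed
    then have "(\<Sum>u\<in>U. \<Sum>v\<in>U. T u v) \<le> (\<Sum>u\<in>U. \<Sum>v\<in>U. N / (20 * r) + of_bool (u = v) * N)"
      by (intro sum_mono) auto
    also have "\<dots> = M\<^sup>2 * (N / (20 * r)) + M * N"
      using fU by (simp add: sum.distrib M_def power2_eq_square of_bool_def if_distrib[of "\<lambda>x. x * N"] distrib_left cong: if_cong)
    finally have "5 * r * (\<Sum>u\<in>U. \<Sum>v\<in>U. T u v) \<le> 5 * r * (M\<^sup>2 * (N / (20 * r)) + M * N)"
      using r by (intro mult_left_mono) auto
    also have "\<dots> = 1/4 * N * M\<^sup>2 + 5 * r * M * N" using r by (simp add: field_simps)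
    also have "5 * r * M * N \<le> M / 4 * M * N"
      using M N \<open>M > 0\<close> by (intro mult_right_mono) auto
    finally have "9/16 * N * M\<^sup>2 \<le> 1/4 * N * M\<^sup>2 + M / 4 * M * N" using low by linarith
    moreover have "N * M\<^sup>2 > 0" using N \<open>M > 0\<close> by simp
    ultimately show False by (simp add: power2_eq_square algebra_simps)
  qed
qed

section \<open>Determining sets and integer points in a ball\<close>

text \<open>Gaussian elimination: subtracting multiples of a \<open>w0\<close> with nonzero last
  coordinate lowers the dimension, and for \<open>y\<close> orthogonal to \<open>w0\<close> this
  leaves all pairings unchanged. So \<open>w0\<close> and lifts of the points found in dimension
  \<open>d\<close> suffice.\<close>

lemma card_le_dim_determining:
  fixes A :: "(nat \<Rightarrow> real) set"
  obtains B where "B \<subseteq> A" "finite B" "card B \<le> d"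
    "\<And>y. (\<forall>w\<in>B. (\<Sum>i<d. y i * w i) = 0) \<Longrightarrow> (\<forall>w\<in>A. (\<Sum>i<d. y i * w i) = 0)"
proof -
  have "\<exists>B\<subseteq>A. finite B \<and> card B \<le> d \<and>
    (\<forall>y. (\<forall>w\<in>B. (\<Sum>i<d. y i * w i) = 0) \<longrightarrow> (\<forall>w\<in>A. (\<Sum>i<d. y i * w i) = 0))"
  proof (induction d arbitrary: A)
    case 0
    show ?case by (rule exI[of _ "{}"]) simp
  next
    case (Suc d)
    show ?case
    proof (cases "\<forall>w\<in>A. w d = 0")
      case True
      obtain B where B: "B \<subseteq> A" "finite B" "card B \<le> d"
        "\<forall>y. (\<forall>w\<in>B. (\<Sum>i<d. y i * w i) = 0) \<longrightarrow> (\<forall>w\<in>A. (\<Sum>i<d. y i * w i) = 0)"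
        using Suc[of A] by (elim exE conjE)
      have "(\<Sum>i<Suc d. y i * w i) = (\<Sum>i<d. y i * w i)" if "w \<in> A" for w and y :: "nat \<Rightarrow> real"
        using True that by simp
      then have "\<forall>w\<in>A. (\<Sum>i<Suc d. y i * w i) = 0" if "\<forall>w\<in>B. (\<Sum>i<Suc d. y i * w i) = 0" for y
        using B(4)[rule_format, of y] that B(1) by (metis subsetD)
      moreover have "card B \<le> Suc d" using B(3) by simp
      ultimately show ?thesis using B(1,2) by iprover
    next
      case False
      then obtain w0 where w0: "w0 \<in> A" "w0 d \<noteq> 0" by auto
      define p where "p = (\<lambda>w i. w i - w d / w0 d * w0 i)"
      have p: "(\<Sum>i<d. y i * p w i) = (\<Sum>i<Suc d. y i * w i) - w d / w0 d * (\<Sum>i<Suc d. y i * w0 i)" for y w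
        using w0(2) by (simp add: p_def algebra_simps sum_subtractf sum_distrib_left)
      obtain B' where B': "B' \<subseteq> p ` A" "finite B'" "card B' \<le> d"
        "\<forall>y. (\<forall>w\<in>B'. (\<Sum>i<d. y i * w i) = 0) \<longrightarrow> (\<forall>w\<in>p`A. (\<Sum>i<d. y i * w i) = 0)"
        using Suc[of "p ` A"] by (elim exE conjE)
      \<comment> \<open>One preimage for each point of \<open>B'\<close> keeps the count at
        \<open>d\<close> before \<open>w0\<close> is added.\<close>
      obtain C where C: "C \<subseteq> A" "finite C" "B' = p ` C" "card C = card B'"
      proof -
        obtain C where "C \<subseteq> A" "inj_on p C" "B' = p ` C" using B'(1) unfolding subset_image_inj by blast
        then show ?thesis using that[of C] B'(2) by (simp add: card_image finite_image_iff)
      qed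
      have perp: "\<forall>w\<in>A. (\<Sum>i<Suc d. y i * w i) = 0"
        if y: "\<forall>w\<in>insert w0 C. (\<Sum>i<Suc d. y i * w i) = 0" for y
      proof -
        have "\<forall>w\<in>B'. (\<Sum>i<d. y i * w i) = 0" using y by (auto simp: C(3) p simp del: sum.lessThan_Suc)
        then have "\<forall>w\<in>A. (\<Sum>i<d. y i * p w i) = 0" using B'(4) by blast
        then show ?thesis using y by (auto simp: p simp del: sum.lessThan_Suc)
      qed
      have "\<forall>y. (\<forall>w\<in>insert w0 C. (\<Sum>i<Suc d. y i * w i) = 0) \<longrightarrow> (\<forall>w\<in>A. (\<Sum>i<Suc d. y i * w i) = 0)"
        by (intro allI impI, rule perp)
      moreover have "insert w0 C \<subseteq> A" "finite (insert w0 C)" "card (insert w0 C) \<le> Suc d"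
        using C w0(1) B'(3) by (auto simp: card_insert_if)
      ultimately show ?thesis by iprover
    qed
  qed
  then obtain B where B: "B \<subseteq> A" "finite B" "card B \<le> d"
    "\<forall>y. (\<forall>w\<in>B. (\<Sum>i<d. y i * w i) = 0) \<longrightarrow> (\<forall>w\<in>A. (\<Sum>i<d. y i * w i) = 0)"
    by (elim exE conjE)
  show ?thesis by (rule that[OF B(1-3) B(4)[THEN spec, THEN mp]])
qed

lemma abs_le_power2_int: "\<bar>k\<bar> \<le> k\<^sup>2" for k :: int
  using self_le_power[of "\<bar>k\<bar>" 2] by (cases "k = 0") auto

text \<open>Generating function: because |k| <= k^2, every point has weight at least 2^(-d) under
  the product of the 2^(-|z i|), while the total weight is at most 3^d. Counting the enclosing cube
  would give a bound of more than exponential growth.\<close>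

lemma card_int_ball_le:
  assumes "finite Z" and Z: "\<And>z. z \<in> Z \<Longrightarrow> z \<in> (\<Pi>\<^sub>E i\<in>B. UNIV) \<and> (\<Sum>i\<in>B. (z i)\<^sup>2) \<le> int d"
    and B: "finite B" "card B \<le> d"
  shows "card Z \<le> 6 ^ d"
proof -
  define I where "I = {- int d..int d}"
  have sub: "Z \<subseteq> (\<Pi>\<^sub>E i\<in>B. I)"
  proof
    fix z assume z: "z \<in> Z"
    have "z i \<in> I" if "i \<in> B" for i
    proof -
      have "(z i)\<^sup>2 \<le> int d" using Z[OF z] member_le_sum[of i B "\<lambda>i. (z i)\<^sup>2"] that B by force
      moreover have "\<bar>z i\<bar> \<le> (z i)\<^sup>2" by (rule abs_le_power2_int)
      ultimately show ?thesis by (auto simp: I_def)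
    qed
    then show "z \<in> (\<Pi>\<^sub>E i\<in>B. I)" using Z[OF z] by (auto simp: PiE_iff)
  qed
  \<comment> \<open>The full series has sum 3; the subtracted term makes the induction
    close.\<close>
  have geo: "(\<Sum>k\<in>{- int m..int m}. (1/2::real) ^ nat \<bar>k\<bar>) \<le> 3 - 2 * (1/2)^m" for m
  proof (induction m)
    case (Suc m)
    have "{- int (Suc m)..int (Suc m)} = insert (int (Suc m)) (insert (- int (Suc m)) {- int m..int m})" by auto
    then have "(\<Sum>k\<in>{- int (Suc m)..int (Suc m)}. (1/2::real) ^ nat \<bar>k\<bar>)
        = 2 * (1/2) ^ Suc m + (\<Sum>k\<in>{- int m..int m}. (1/2) ^ nat \<bar>k\<bar>)"
      by (simp add: nat_add_distrib)
    then show ?case using Suc by simp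
  qed auto
  have "real (card Z) * (1/2)^d = (\<Sum>z\<in>Z. (1/2)^d)" by simp
  also have "\<dots> \<le> (\<Sum>z\<in>Z. \<Prod>i\<in>B. (1/2) ^ nat \<bar>z i\<bar>)"
  proof (intro sum_mono)
    fix z assume z: "z \<in> Z"
    have "int (\<Sum>i\<in>B. nat \<bar>z i\<bar>) = (\<Sum>i\<in>B. \<bar>z i\<bar>)" by simp
    also have "\<dots> \<le> (\<Sum>i\<in>B. (z i)\<^sup>2)"
      by (intro sum_mono abs_le_power2_int)
    also have "\<dots> \<le> int d" using Z[OF z] by auto
    finally have "(\<Sum>i\<in>B. nat \<bar>z i\<bar>) \<le> d" by linarith
    then show "(1/2::real)^d \<le> (\<Prod>i\<in>B. (1/2) ^ nat \<bar>z i\<bar>)"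
      unfolding power_sum[symmetric] by (intro power_decreasing) auto
  qed
  also have "\<dots> \<le> (\<Sum>z\<in>(\<Pi>\<^sub>E i\<in>B. I). \<Prod>i\<in>B. (1/2) ^ nat \<bar>z i\<bar>)"
    using sub B by (intro sum_mono2 finite_PiE) (auto simp: I_def intro!: prod_nonneg)
  also have "\<dots> = (\<Prod>i\<in>B. \<Sum>k\<in>I. (1/2) ^ nat \<bar>k\<bar>)"
    using B by (intro prod_sum_PiE[symmetric]) (auto simp: I_def)
  also have "\<dots> \<le> (\<Prod>i\<in>B. 3)"
    using geo[of d] by (intro prod_mono conjI sum_nonneg order_trans[OF geo[of d, folded I_def]]) auto
  also have "\<dots> \<le> 3 ^ d" using B by (simp add: power_increasing)
  finally have "real (card Z) \<le> 3 ^ d * 2 ^ d" by (simp add: field_simps)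
  then have "real (card Z) \<le> real (6 ^ d)" by (simp flip: power_mult_distrib)
  then show ?thesis by linarith
qed

subsection \<open>Gram--Schmidt coordinates and dual boxes\<close>

text \<open>Gram--Schmidt orthogonalisation of the coordinate functionals in \<open>\<ell>\<^sup>2(S)\<close>. If a
  denominator vanishes, then \<open>gs S j\<close> vanishes on \<open>S\<close> and the coefficient 0 given by
  division by zero is still correct.\<close>
function gs :: "(nat \<Rightarrow> real) set \<Rightarrow> nat \<Rightarrow> (nat \<Rightarrow> real) \<Rightarrow> real" where
  "gs S i x = x i - (\<Sum>j<i. (\<Sum>w\<in>S. w i * gs S j w) / (\<Sum>w\<in>S. (gs S j w)\<^sup>2) * gs S j x)"
  by pat_completeness auto
termination by (relation "Wellfounded.measure (\<lambda>(S, i, x). i)") auto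
declare gs.simps [simp del]

definition gs_coeff :: "(nat \<Rightarrow> real) set \<Rightarrow> nat \<Rightarrow> nat \<Rightarrow> real" where
  "gs_coeff S i j = (\<Sum>w\<in>S. w i * gs S j w) / (\<Sum>w\<in>S. (gs S j w)\<^sup>2)"

lemma gs_eq: "gs S i x = x i - (\<Sum>j<i. gs_coeff S i j * gs S j x)"
  by (subst gs.simps) (simp add: gs_coeff_def)

lemma gs_cong: "(\<And>j. j \<le> i \<Longrightarrow> x j = y j) \<Longrightarrow> gs S i x = gs S i y"
proof (induction i rule: less_induct)
  case (less i)
  then have "gs S j x = gs S j y" if "j < i" for j using that by simp
  then show ?case using less.prems by (simp add: gs_eq[of S i])
qed

lemma gs_orthogonal:
  assumes "finite S" "j < i"
  shows "(\<Sum>w\<in>S. gs S i w * gs S j w) = 0"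
  using \<open>j < i\<close>
proof (induction i arbitrary: j rule: less_induct)
  case (less i)
  have orth: "(\<Sum>w\<in>S. gs S k w * gs S j w) = of_bool (k = j) * (\<Sum>w\<in>S. (gs S j w)\<^sup>2)" if "k < i" for k
    using less.IH[of k j] less.IH[of j k] less.prems that
    by (cases k j rule: linorder_cases) (auto simp: mult.commute power2_eq_square)
  have "(\<Sum>w\<in>S. gs S i w * gs S j w)
      = (\<Sum>w\<in>S. w i * gs S j w) - (\<Sum>w\<in>S. \<Sum>k<i. gs_coeff S i k * (gs S k w * gs S j w))"
    by (simp add: gs_eq[of S i] left_diff_distrib sum_subtractf sum_distrib_right mult.assoc)
  also have "(\<Sum>w\<in>S. \<Sum>k<i. gs_coeff S i k * (gs S k w * gs S j w))
      = (\<Sum>k<i. gs_coeff S i k * (\<Sum>w\<in>S. gs S k w * gs S j w))"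
    by (subst sum.swap) (simp add: sum_distrib_left)
  also have "\<dots> = (\<Sum>k<i. if k = j then gs_coeff S i j * (\<Sum>w\<in>S. (gs S j w)\<^sup>2) else 0)"
    using orth by (intro sum.cong) auto
  also have "\<dots> = gs_coeff S i j * (\<Sum>w\<in>S. (gs S j w)\<^sup>2)" using less.prems by simp
  also have "\<dots> = (\<Sum>w\<in>S. w i * gs S j w)"
  proof (cases "(\<Sum>w\<in>S. (gs S j w)\<^sup>2) = 0")
    case True
    then have "\<forall>w\<in>S. gs S j w = 0" using \<open>finite S\<close> by (simp add: sum_nonneg_eq_0_iff)
    then show ?thesis using True by simp
  qed (simp add: gs_coeff_def)
  finally show ?case by simp
qed

definition gs_norm :: "(nat \<Rightarrow> real) set \<Rightarrow> nat \<Rightarrow> real" where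
  "gs_norm S i = sqrt (\<Sum>w\<in>S. (gs S i w)\<^sup>2)"

lemma gs_norm_nonneg: "gs_norm S i \<ge> 0" by (simp add: gs_norm_def sum_nonneg)

lemma gs_orthonormal:
  assumes "finite S"
  shows "(\<Sum>w\<in>S. gs S i w * gs S j w) = of_bool (i = j) * (gs_norm S j)\<^sup>2"
  using gs_orthogonal[OF assms, of i j] gs_orthogonal[OF assms, of j i]
  by (cases i j rule: linorder_cases)
     (auto simp: gs_norm_def sum_nonneg mult.commute power2_eq_square)

lemma gs_parseval:
  assumes "finite S"
  shows "(\<Sum>w\<in>S. (\<Sum>i<d. a i * gs S i w)\<^sup>2) = (\<Sum>i<d. (a i)\<^sup>2 * (gs_norm S i)\<^sup>2)"
proof -
  have "(\<Sum>w\<in>S. (\<Sum>i<d. a i * gs S i w)\<^sup>2)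
      = (\<Sum>w\<in>S. \<Sum>i<d. \<Sum>j<d. a i * a j * (gs S i w * gs S j w))"
    by (simp add: power2_eq_square sum_product mult_ac)
  also have "\<dots> = (\<Sum>i<d. \<Sum>w\<in>S. \<Sum>j<d. a i * a j * (gs S i w * gs S j w))" by (rule sum.swap)
  also have "\<dots> = (\<Sum>i<d. \<Sum>j<d. a i * a j * (\<Sum>w\<in>S. gs S i w * gs S j w))"
    unfolding sum_distrib_left by (intro sum.cong refl sum.swap)
  also have "\<dots> = (\<Sum>i<d. \<Sum>j<d. if i = j then a j * a j * (gs_norm S j)\<^sup>2 else 0)"
    by (intro sum.cong) (auto simp: gs_orthonormal[OF assms])
  also have "\<dots> = (\<Sum>i<d. (a i)\<^sup>2 * (gs_norm S i)\<^sup>2)"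
    by (intro sum.cong) (auto simp: power2_eq_square)
  finally show ?thesis .
qed

text \<open>The coefficient of \<open>gs S j\<close> in the functional \<open>w \<mapsto> \<Sum>i<d. u i * w i\<close>.\<close>
definition gs_dual :: "(nat \<Rightarrow> real) set \<Rightarrow> nat \<Rightarrow> nat \<Rightarrow> (nat \<Rightarrow> real) \<Rightarrow> real" where
  "gs_dual S d j u = u j + (\<Sum>i\<in>{j<..<d}. gs_coeff S i j * u i)"

lemma inner_eq_gs_dual: "(\<Sum>i<d. u i * w i) = (\<Sum>j<d. gs_dual S d j u * gs S j w)"
proof -
  have *: "{..<d} \<inter> {j. j < i} = {..<i}" if "i < d" for i using that by auto
  have **: "{..<d} \<inter> {i. j < i} = {j<..<d}" for j by auto
  have expand: "w i = gs S i w + (\<Sum>j<i. gs_coeff S i j * gs S j w)" for i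
    by (subst gs_eq) simp
  have "(\<Sum>i<d. u i * w i) = (\<Sum>i<d. u i * gs S i w + (\<Sum>j<i. gs_coeff S i j * u i * gs S j w))"
    by (intro sum.cong refl, subst expand) (simp add: distrib_left sum_distrib_left mult_ac)
  also have "\<dots> = (\<Sum>i<d. u i * gs S i w) + (\<Sum>i<d. \<Sum>j<d. if j < i then gs_coeff S i j * u i * gs S j w else 0)"
    by (simp add: sum.distrib sum.If_cases *)
  also have "\<dots> = (\<Sum>i<d. u i * gs S i w) + (\<Sum>j<d. \<Sum>i<d. if j < i then gs_coeff S i j * u i * gs S j w else 0)"
    by (subst sum.swap) simp
  also have "\<dots> = (\<Sum>j<d. gs_dual S d j u * gs S j w)"
    by (simp add: gs_dual_def sum.distrib sum.If_cases ** algebra_simps sum_distrib_left)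
  finally show ?thesis .
qed

text \<open>The dual coordinates diagonalise the second-moment form of \<open>S\<close>, so a box in
  these coordinates controls the mean square of a functional.\<close>

lemma sum_inner_squared:
  assumes "finite S"
  shows "(\<Sum>w\<in>S. (\<Sum>i<d. u i * w i)\<^sup>2) = (\<Sum>j<d. (gs_dual S d j u)\<^sup>2 * (gs_norm S j)\<^sup>2)"
  by (subst inner_eq_gs_dual[of _ _ _ S]) (rule gs_parseval[OF assms])

lemma gs_dual_diff: "gs_dual S d j (\<lambda>i. u i - v i) = gs_dual S d j u - gs_dual S d j v"
  by (simp add: gs_dual_def algebra_simps sum_subtractf)

section \<open>Many integer vectors in a box of dual coordinates\<close>

text \<open>Averaging over the translate \<open>t\<close> costs at most a factor 2.\<close>
lemma dense_integer_interval:
  fixes s :: "'a \<Rightarrow> real" and L :: real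
  assumes U: "finite U" "U \<noteq> {}" and "L > 0"
  obtains t where "finite (SIGMA u:U. {m::int. t \<le> m + s u \<and> m + s u < t + L})"
    "card (SIGMA u:U. {m::int. t \<le> m + s u \<and> m + s u < t + L}) \<ge> card U * (L / 2)"
proof -
  have fin: "finite {m::int. t \<le> m + s u \<and> m + s u < t + L}" for t u
  proof (rule finite_subset)
    show "{m::int. t \<le> m + s u \<and> m + s u < t + L} \<subseteq> {\<lfloor>t - s u\<rfloor>..\<lceil>t + L - s u\<rceil>}"
      by (auto; linarith)
  qed simp
  have finS: "finite (SIGMA u:U. {m::int. t \<le> m + s u \<and> m + s u < t + L})" for t
    using U fin by auto
  show ?thesis
  proof (cases "L \<ge> 1")
    case True
    \<comment> \<open>A half-open interval of length \<open>L\<close> contains at least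
      \<open>\<lfloor>L\<rfloor>\<close> integers wherever it lies, so the translate 0 will
      do.\<close>
    have "card {m::int. 0 \<le> m + s u \<and> m + s u < 0 + L} \<ge> L / 2" for u
    proof -
      define a where "a = \<lceil>- s u\<rceil>"
      have "{a..a + \<lfloor>L\<rfloor> - 1} \<subseteq> {m::int. 0 \<le> m + s u \<and> m + s u < 0 + L}"
        unfolding a_def by (auto; linarith)
      from card_mono[OF fin[of 0 u, simplified] this[simplified]]
      have "nat \<lfloor>L\<rfloor> \<le> card {m::int. 0 \<le> m + s u \<and> m + s u < 0 + L}" by simp
      moreover have "real (nat \<lfloor>L\<rfloor>) \<ge> L / 2" 
      proof -
        have "\<lfloor>L\<rfloor> \<ge> 1" using True by simp
        then show ?thesis by linarith
      qed
      ultimately show ?thesis by linarith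
    qed
    then have "(\<Sum>u\<in>U. L/2) \<le> (\<Sum>u\<in>U. real (card {m::int. 0 \<le> m + s u \<and> m + s u < 0 + L}))"
      by (intro sum_mono)
    then show ?thesis using that[of 0] finS[of 0] U fin[of 0] by simp
  next
    case False
    \<comment> \<open>Split the fractional parts of \<open>s u\<close> into \<open>n\<close> cells
      of length 1/n <= L. Some cell holds at least \<open>card U / n\<close> elements, and
      \<open>m = - \<lfloor>s u\<rfloor>\<close> moves \<open>s u\<close> into it; n <= 2/L is where
      the factor 2 is lost.\<close>
    define n where "n = nat \<lceil>1 / L\<rceil>"
    have n: "real n \<ge> 1 / L" "real n \<le> 2 / L" "n > 0"
    proof -
      have "1 / L \<ge> 1" using False \<open>L > 0\<close> by simp
      moreover have "2 / L = 1 / L + 1 / L" by simp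
      ultimately show "real n \<ge> 1 / L" "real n \<le> 2 / L" "n > 0" unfolding n_def by linarith+
    qed
    define f where "f = (\<lambda>u. nat \<lfloor>n * frac (s u)\<rfloor>)"
    have "f u < n" for u
      using frac_lt_1[of "s u"] frac_ge_0[of "s u"] n unfolding f_def
      by (simp add: nat_less_iff floor_less_iff)
    then obtain k where k: "card (f -` {k} \<inter> U) * n \<ge> card U"
      using pigeonhole_card[of f U "{..<n}"] U n by (auto simp: Pi_iff)
    have "k / n \<le> - \<lfloor>s u\<rfloor> + s u \<and> - \<lfloor>s u\<rfloor> + s u < k / n + L" if "f u = k" for u
    proof -
      have "real k \<le> n * frac (s u)" "n * frac (s u) < k + 1"
        using that frac_ge_0[of "s u"] n unfolding f_def by (auto simp: nat_eq_iff) linarith+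
      then have "k / n \<le> frac (s u)" "frac (s u) < (k + 1) / n" using n by (auto simp: field_simps)
      moreover have "(k + 1) / n \<le> k / n + L" using n \<open>L > 0\<close> by (simp add: field_simps)
      ultimately show ?thesis by (simp add: frac_def)
    qed
    then have sub: "(\<lambda>u. (u, - \<lfloor>s u\<rfloor>)) ` (f -` {k} \<inter> U) \<subseteq> (SIGMA u:U. {m::int. k / n \<le> m + s u \<and> m + s u < k / n + L})"
      by auto
    have "card (f -` {k} \<inter> U) \<le> card (SIGMA u:U. {m::int. k / n \<le> m + s u \<and> m + s u < k / n + L})"
      using card_mono[OF finS sub] by (subst (asm) card_image) (auto simp: inj_on_def)
    moreover have "card (f -` {k} \<inter> U) \<ge> card U * (L / 2)"
    proof -
      have "real (card U) \<le> real (card (f -` {k} \<inter> U)) * n" using k by (metis of_nat_le_iff of_nat_mult)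
      also have "\<dots> \<le> real (card (f -` {k} \<inter> U)) * (2 / L)" using n by (intro mult_left_mono) auto
      finally show ?thesis using \<open>L > 0\<close> by (simp add: field_simps)
    qed
    ultimately show ?thesis using that[of "k / n"] finS by fastforce
  qed
qed

text \<open>\<open>gs_dual S d p\<close> involves only entries \<open>u i\<close> with
  \<open>i \<ge> p\<close>, and \<open>u p\<close> with coefficient 1. So entries are chosen from
  the last to the first: each step leaves the later dual coordinates alone, uses one translate for
  all \<open>u\<close>, and multiplies the count by at least \<open>L p / 2\<close>.\<close>

lemma dense_integer_box:
  fixes L :: "nat \<Rightarrow> real"
  assumes L: "\<And>j. j < d \<Longrightarrow> L j > 0"
  obtains U :: "(nat \<Rightarrow> int) set" where "finite U" "U \<noteq> {}"
    "\<And>u i. u \<in> U \<Longrightarrow> i \<ge> d \<Longrightarrow> u i = 0"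
    "\<And>u v j. u \<in> U \<Longrightarrow> v \<in> U \<Longrightarrow> j < d \<Longrightarrow>
       \<bar>gs_dual S d j (of_int \<circ> u) - gs_dual S d j (of_int \<circ> v)\<bar> \<le> L j"
    "card U \<ge> (\<Prod>j<d. L j / 2)"
proof -
  define P where "P = (\<lambda>k (U :: (nat \<Rightarrow> int) set).
     finite U \<and> U \<noteq> {} \<and> (\<forall>u\<in>U. \<forall>i. i < d - k \<or> i \<ge> d \<longrightarrow> u i = 0) \<and>
     (\<forall>u\<in>U. \<forall>v\<in>U. \<forall>j\<in>{d - k..<d}.
       \<bar>gs_dual S d j (of_int \<circ> u) - gs_dual S d j (of_int \<circ> v)\<bar> \<le> L j) \<and>
     card U \<ge> (\<Prod>j\<in>{d - k..<d}. L j / 2))"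
  have "\<exists>U. P k U" if "k \<le> d" for k
    using that
  proof (induction k)
    case 0
    show ?case by (intro exI[of _ "{\<lambda>_. 0}"]) (auto simp: P_def)
  next
    case (Suc k)
    then obtain U where PU: "P k U" by auto
    have U: "finite U" "U \<noteq> {}"
      and supp: "\<And>u i. u \<in> U \<Longrightarrow> i < d - k \<or> i \<ge> d \<Longrightarrow> u i = 0"
      and close: "\<And>u v j. u \<in> U \<Longrightarrow> v \<in> U \<Longrightarrow> j \<in> {d - k..<d} \<Longrightarrow>
       \<bar>gs_dual S d j (of_int \<circ> u) - gs_dual S d j (of_int \<circ> v)\<bar> \<le> L j"
      and crd: "card U \<ge> (\<Prod>j\<in>{d - k..<d}. L j / 2)"
      using PU by (auto simp: P_def)
    define p where "p = d - Suc k"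
    have p: "p < d" "d - k = Suc p" using Suc.prems by (auto simp: p_def)
    define s where "s = (\<lambda>u::nat\<Rightarrow>int. \<Sum>i\<in>{p<..<d}. gs_coeff S i p * u i)"
    obtain t where t: "finite (SIGMA u:U. {m::int. t \<le> m + s u \<and> m + s u < t + L p})"
      "card (SIGMA u:U. {m::int. t \<le> m + s u \<and> m + s u < t + L p}) \<ge> card U * (L p / 2)"
      by (rule dense_integer_interval[OF U L[OF p(1)], of s])
    define D where "D = (SIGMA u:U. {m::int. t \<le> m + s u \<and> m + s u < t + L p})"
    define V where "V = (\<lambda>(u, m). u(p := m)) ` D"
    \<comment> \<open>\<open>u\<close> is recovered from its extension because its entry at
      \<open>p\<close> was still 0.\<close>
    have inj: "inj_on (\<lambda>(u, m). u(p := m)) D"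
    proof (rule inj_onI, clarsimp)
      fix u m u' m' assume D: "(u, m) \<in> D" "(u', m') \<in> D" and eq: "u(p := m) = u'(p := m')"
      have "u p = 0" "u' p = 0" using D supp p by (auto simp: D_def)
      with eq show "u = u' \<and> m = m'" by (metis fun_upd_idem_iff fun_upd_same fun_upd_upd)
    qed
    have dual_p: "gs_dual S d p (of_int \<circ> u(p := m)) = m + s u" for u m
      by (simp add: gs_dual_def s_def)
    have dual_j: "gs_dual S d j (of_int \<circ> u(p := m)) = gs_dual S d j (of_int \<circ> u)" if "p < j" for j u m
      using that by (auto simp: gs_dual_def intro!: sum.cong)
    have "(\<Prod>j\<in>{p..<d}. L j / 2) = (\<Prod>j\<in>{d - k..<d}. L j / 2) * (L p / 2)"
      using p by (simp add: prod.atLeast_Suc_lessThan)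
    also have "\<dots> \<le> card U * (L p / 2)" using crd L[of p] p by (intro mult_right_mono) auto
    also have "\<dots> \<le> card V" using t inj unfolding V_def D_def[symmetric] by (simp add: card_image)
    finally have cV: "(\<Prod>j\<in>{p..<d}. L j / 2) \<le> card V" .
    moreover have "(\<Prod>j\<in>{p..<d}. L j / 2) > 0" using L by (intro prod_pos) auto
    ultimately have "V \<noteq> {}" by auto
    moreover have "finite V" using t by (simp add: V_def D_def)
    moreover have "\<forall>u\<in>V. \<forall>i. i < p \<or> i \<ge> d \<longrightarrow> u i = 0" using supp p by (auto simp: V_def D_def)
    moreover have "\<bar>gs_dual S d j (of_int \<circ> u) - gs_dual S d j (of_int \<circ> v)\<bar> \<le> L j"
      if "u \<in> V" "v \<in> V" "j \<in> {p..<d}" for u v j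
    proof -
      from that obtain u' m v' n where uv: "u = u'(p := m)" "v = v'(p := n)" "(u', m) \<in> D" "(v', n) \<in> D"
        by (auto simp: V_def)
      show ?thesis
      proof (cases "j = p")
        case True
        then show ?thesis using uv unfolding uv(1,2) by (auto simp only: dual_p D_def mem_Sigma_iff mem_Collect_eq)
      next
        case False
        then have "p < j" "j \<in> {d - k..<d}" using that p by auto
        then show ?thesis using close[of u' v' j] uv unfolding uv(1,2) by (simp only: dual_j D_def mem_Sigma_iff)
      qed
    qed
    ultimately have "P (Suc k) V" using cV unfolding P_def p_def[symmetric] by simp
    then show ?case by blast
  qed
  then obtain U where "P d U" by auto
  then show ?thesis
    unfolding P_def by (intro that[of U]) (simp_all add: lessThan_atLeast0)
qed

subsection \<open>Volume of convex bodies\<close>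

interpretation lborel_product: product_sigma_finite "\<lambda>_ :: nat. lborel :: real measure" ..

lemma measurable_gs:
  "i < n \<Longrightarrow> gs S i \<in> borel_measurable (Pi\<^sub>M {..<n} (\<lambda>_. lborel))"
proof (induction i rule: less_induct)
  case (less i)
  have comp: "(\<lambda>x. x i) \<in> borel_measurable (Pi\<^sub>M {..<n} (\<lambda>_. lborel :: real measure))"
    using measurable_component_singleton[of i "{..<n}" "\<lambda>_. lborel :: real measure"] less.prems by simp
  have "(\<lambda>x. \<Sum>j<i. gs_coeff S i j * gs S j x) \<in> borel_measurable (Pi\<^sub>M {..<n} (\<lambda>_. lborel))"
    using less by (intro borel_measurable_sum borel_measurable_times borel_measurable_const) auto
  from borel_measurable_diff[OF comp this] show ?case
    by (simp add: gs_eq[symmetric])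
qed

definition gs_box :: "(nat \<Rightarrow> real) set \<Rightarrow> nat \<Rightarrow> (nat \<Rightarrow> real) \<Rightarrow> (nat \<Rightarrow> real) set" where
  "gs_box S n q = {x \<in> Rd n. \<forall>i<n. \<bar>gs S i x\<bar> \<le> q i}"

lemma sets_gs_box: "gs_box S n q \<in> sets (Pi\<^sub>M {..<n} (\<lambda>_. lborel))"
proof -
  have "gs_box S n q = {x \<in> space (Pi\<^sub>M {..<n} (\<lambda>_. lborel :: real measure)). \<forall>i\<in>{..<n}. \<bar>gs S i x\<bar> \<le> q i}"
    by (auto simp: gs_box_def Rd_def space_PiM)
  also have "\<dots> \<in> sets (Pi\<^sub>M {..<n} (\<lambda>_. lborel))"
  proof (rule sets.sets_Collect_finite_All)
    fix i assume "i \<in> {..<n}"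
    then have [measurable]: "gs S i \<in> borel_measurable (Pi\<^sub>M {..<n} (\<lambda>_. lborel))"
      by (intro measurable_gs) auto
    show "{x \<in> space (Pi\<^sub>M {..<n} (\<lambda>_. lborel :: real measure)). \<bar>gs S i x\<bar> \<le> q i} \<in> sets (Pi\<^sub>M {..<n} (\<lambda>_. lborel))"
      by measurable
  qed simp
  finally show ?thesis .
qed

text \<open>The functionals are unitriangular, so the Gram--Schmidt change of coordinates preserves volume.\<close>
lemma emeasure_gs_box:
  assumes "\<And>i. i < n \<Longrightarrow> q i \<ge> 0"
  shows "emeasure (Pi\<^sub>M {..<n} (\<lambda>_. lborel)) (gs_box S n q) = (\<Prod>i<n. ennreal (2 * q i))"
  using assms
proof (induction n)
  case 0
  have "gs_box S 0 q = {\<lambda>_. undefined}" by (auto simp: gs_box_def Rd_def)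
  then show ?case by simp
next
  case (Suc n)
  \<comment> \<open>For fixed \<open>x\<close> the last functional is \<open>y - \<psi> x\<close>,
    so each fibre of the box is an interval of length \<open>2 * q n\<close> and Fubini
    applies.\<close>
  define \<psi> where "\<psi> = (\<lambda>x. \<Sum>j<n. gs_coeff S n j * gs S j x)"
  have ins: "{..<Suc n} = insert n {..<n}" by auto
  have upd: "indicator (gs_box S (Suc n) q) (x(n := y))
      = indicator (gs_box S n q) x * (indicator {\<psi> x - q n..\<psi> x + q n} y :: ennreal)"
    if "x \<in> space (Pi\<^sub>M {..<n} (\<lambda>_. lborel :: real measure))" for x y
  proof -
    have "gs S i (x(n := y)) = gs S i x" if "i < n" for i
      using that by (intro gs_cong) auto
    moreover from this have "gs S n (x(n := y)) = y - \<psi> x"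
      unfolding \<psi>_def by (subst gs_eq) simp
    moreover have "x \<in> Rd n" "x(n := y) \<in> Rd (Suc n)"
      using that by (auto simp: space_PiM Rd_def PiE_iff extensional_def)
    ultimately have "x(n := y) \<in> gs_box S (Suc n) q \<longleftrightarrow> x \<in> gs_box S n q \<and> y \<in> {\<psi> x - q n..\<psi> x + q n}"
      by (auto simp: gs_box_def less_Suc_eq abs_le_iff)
    then show ?thesis by (simp add: indicator_def)
  qed
  have "emeasure (Pi\<^sub>M {..<Suc n} (\<lambda>_. lborel)) (gs_box S (Suc n) q)
      = (\<integral>\<^sup>+ x. indicator (gs_box S (Suc n) q) x \<partial>(Pi\<^sub>M (insert n {..<n}) (\<lambda>_. lborel)))"
    using sets_gs_box[of S "Suc n" q] by (simp add: ins)
  also have "\<dots> = (\<integral>\<^sup>+ x. (\<integral>\<^sup>+ y. indicator (gs_box S (Suc n) q) (x(n := y)) \<partial>lborel) \<partial>(Pi\<^sub>M {..<n} (\<lambda>_. lborel)))"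
    using sets_gs_box[of S "Suc n" q] by (intro lborel_product.product_nn_integral_insert) (auto simp: ins)
  also have "\<dots> = (\<integral>\<^sup>+ x. indicator (gs_box S n q) x * ennreal (2 * q n) \<partial>(Pi\<^sub>M {..<n} (\<lambda>_. lborel)))"
    using Suc.prems[of n] by (intro nn_integral_cong) (simp add: upd nn_integral_cmult)
  also have "\<dots> = emeasure (Pi\<^sub>M {..<n} (\<lambda>_. lborel)) (gs_box S n q) * ennreal (2 * q n)"
    using sets_gs_box[of S n q] by (simp add: nn_integral_multc)
  finally show ?case using Suc by simp
qed

text \<open>Symmetry absorbs the signs of the coefficients as well as the weight missing from 1;
  convexity does the rest.\<close>

lemma abs_convex_combination:
  assumes "convex_in d K" "origin_symmetric d K" "S \<subseteq> K" "finite S" "S \<noteq> {}"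
    and x: "x \<in> Rd d" "\<And>i. i < d \<Longrightarrow> x i = (\<Sum>w\<in>S. a w * w i)" and a: "(\<Sum>w\<in>S. \<bar>a w\<bar>) \<le> 1"
  shows "x \<in> K"
proof -
  have conv: "(\<lambda>i\<in>{..<d}. u * p i + v * q i) \<in> K" if "p \<in> K" "q \<in> K" "u \<ge> 0" "v \<ge> 0" "u + v = 1" for p q u v
    using assms(1) that unfolding convex_in_def by blast
  have neg: "(\<lambda>i\<in>{..<d}. - p i) \<in> K" if "p \<in> K" for p
    using assms(2) that unfolding origin_symmetric_def by blast
  \<comment> \<open>Multiplying by the total weight, and not dividing by it, also covers weight
    0.\<close>
  have sub: "F \<subseteq> S \<Longrightarrow> \<exists>k\<in>K. \<forall>i<d. (\<Sum>w\<in>F. a w * w i) = (\<Sum>w\<in>F. \<bar>a w\<bar>) * k i" if "finite F" for F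
    using that
  proof (induction F)
    case empty
    then show ?case using assms(3,5) by auto
  next
    case (insert w F)
    then obtain k where k: "k \<in> K" "\<forall>i<d. (\<Sum>w\<in>F. a w * w i) = (\<Sum>w\<in>F. \<bar>a w\<bar>) * k i" by auto
    define T where "T = (\<Sum>w\<in>F. \<bar>a w\<bar>)"
    have T: "T \<ge> 0" unfolding T_def by (simp add: sum_nonneg)
    have w: "w \<in> K" using insert.prems assms(3) by auto
    define w' where "w' = (if a w \<ge> 0 then w else (\<lambda>i\<in>{..<d}. - w i))"
    have w': "w' \<in> K" "\<forall>i<d. a w * w i = \<bar>a w\<bar> * w' i" using w neg[OF w] by (auto simp: w'_def)
    show ?case
    proof (cases "T + \<bar>a w\<bar> = 0")
      case True
      then have "T = 0" "a w = 0" using T by auto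
      then show ?thesis using k insert.hyps by (intro bexI[of _ k]) (auto simp: T_def[symmetric])
    next
      case False
      then have pos: "T + \<bar>a w\<bar> > 0" using T by auto
      define k' where "k' = (\<lambda>i\<in>{..<d}. T / (T + \<bar>a w\<bar>) * k i + \<bar>a w\<bar> / (T + \<bar>a w\<bar>) * w' i)"
      have "k' \<in> K" unfolding k'_def
        using k(1) w'(1) T pos by (intro conv) (auto simp: add_divide_distrib[symmetric])
      moreover have "(\<Sum>w\<in>insert w F. a w * w i) = (\<Sum>w\<in>insert w F. \<bar>a w\<bar>) * k' i" if "i < d" for i
      proof -
        have "(T + \<bar>a w\<bar>) * k' i = T * k i + \<bar>a w\<bar> * w' i"
          using that pos by (simp add: k'_def distrib_left)
        then show ?thesis using that k(2) w'(2) insert.hyps by (simp add: T_def[symmetric] add.commute)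
      qed
      ultimately show ?thesis by blast
    qed
  qed
  obtain k where k: "k \<in> K" "\<forall>i<d. x i = (\<Sum>w\<in>S. \<bar>a w\<bar>) * k i"
    using sub[OF \<open>finite S\<close>] x(2) by auto
  define T where "T = (\<Sum>w\<in>S. \<bar>a w\<bar>)"
  have T: "T \<ge> 0" unfolding T_def by (simp add: sum_nonneg)
  \<comment> \<open>As (1 + T)/2 - (1 - T)/2 = T, this mixture of \<open>k\<close> and its negative
    is \<open>T\<close> times \<open>k\<close>.\<close>
  have "(\<lambda>i\<in>{..<d}. (1 + T) / 2 * k i + (1 - T) / 2 * (\<lambda>i\<in>{..<d}. - k i) i) \<in> K"
    using T a by (intro conv[OF k(1) neg[OF k(1)]]) (auto simp: T_def[symmetric] field_simps)
  also have "(\<lambda>i\<in>{..<d}. (1 + T) / 2 * k i + (1 - T) / 2 * (\<lambda>i\<in>{..<d}. - k i) i) = x"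
    using x(1) k(2) by (auto simp: T_def[symmetric] fun_eq_iff field_simps Rd_def PiE_iff extensional_def)
  finally show ?thesis .
qed

text \<open>
  After normalising the uniform measure on \<open>S\<close> to isotropic position, \<open>K\<close> contains the unit ball:
  \<open>x\<close> is the average of the points \<open>w\<close> with weights \<open>\<langle>w, x\<rangle>\<close>, and these weights have
  \<open>L\<^sup>1\<close> norm at most their \<open>L\<^sup>2\<close> norm. The box below is a cube inside that ball.
\<close>
lemma gs_box_subset:
  assumes K: "convex_in d K" "origin_symmetric d K" "S \<subseteq> K" "finite S" "S \<noteq> {}"
    and pos: "\<And>i. i < d \<Longrightarrow> gs_norm S i > 0"
  shows "gs_box S d (\<lambda>i. gs_norm S i / sqrt (d * card S)) \<subseteq> K"
proof
  fix x assume x: "x \<in> gs_box S d (\<lambda>i. gs_norm S i / sqrt (d * card S))"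
  \<comment> \<open>This pairs \<open>x\<close> with \<open>w\<close> by the inverse second-moment
    matrix of \<open>S\<close>, written in the orthogonal basis.\<close>
  define a where "a = (\<lambda>w. \<Sum>i<d. gs S i x / (gs_norm S i)\<^sup>2 * gs S i w)"
  have coord: "(\<Sum>w\<in>S. a w * gs S k w) = gs S k x" if "k < d" for k
  proof -
    have "(\<Sum>w\<in>S. a w * gs S k w) = (\<Sum>w\<in>S. \<Sum>i<d. gs S i x / (gs_norm S i)\<^sup>2 * (gs S i w * gs S k w))"
      by (simp add: a_def sum_distrib_right mult.assoc)
    also have "\<dots> = (\<Sum>i<d. gs S i x / (gs_norm S i)\<^sup>2 * (\<Sum>w\<in>S. gs S i w * gs S k w))"
      by (subst sum.swap) (simp add: sum_distrib_left)
    also have "\<dots> = (\<Sum>i<d. if i = k then gs S k x else 0)"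
      using pos[OF that] by (intro sum.cong) (auto simp: gs_orthonormal[OF K(4)])
    finally show ?thesis using that by simp
  qed
  have "(\<Sum>w\<in>S. a w * w i) = x i" if "i < d" for i
  proof -
    have expand: "w i = gs S i w + (\<Sum>j<i. gs_coeff S i j * gs S j w)" for w
      by (subst gs_eq) simp
    have "(\<Sum>w\<in>S. a w * w i) = (\<Sum>w\<in>S. a w * gs S i w + (\<Sum>j<i. gs_coeff S i j * (a w * gs S j w)))"
      by (intro sum.cong refl, subst expand) (simp add: distrib_left sum_distrib_left mult_ac)
    also have "\<dots> = (\<Sum>w\<in>S. a w * gs S i w) + (\<Sum>j<i. gs_coeff S i j * (\<Sum>w\<in>S. a w * gs S j w))"
      by (simp only: sum.distrib sum.swap[of _ "{..<i}" S] sum_distrib_left)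
    also have "\<dots> = gs S i x + (\<Sum>j<i. gs_coeff S i j * gs S j x)"
      using that by (simp add: coord)
    also have "\<dots> = x i" by (rule expand[symmetric])
    finally show ?thesis .
  qed
  moreover have "(\<Sum>w\<in>S. \<bar>a w\<bar>) \<le> 1"
  proof -
    have S: "real (card S) > 0" using K by (simp add: card_gt_0_iff)
    \<comment> \<open>Passing from L1 to L2 costs a factor \<open>card S\<close>; the half-widths of
      the box are such that each of the \<open>d\<close> coordinates contributes at most
      \<open>1 / (d * card S)\<close>.\<close>
    have "(\<Sum>w\<in>S. \<bar>a w\<bar>)\<^sup>2 \<le> (\<Sum>w\<in>S. (a w)\<^sup>2) * card S"
      using sum_squared_le_sum_of_squares[of "\<lambda>w. \<bar>a w\<bar>" S] by simp
    also have "(\<Sum>w\<in>S. (a w)\<^sup>2) = (\<Sum>i<d. (gs S i x / (gs_norm S i)\<^sup>2)\<^sup>2 * (gs_norm S i)\<^sup>2)"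
      unfolding a_def by (rule gs_parseval[OF K(4)])
    also have "\<dots> \<le> (\<Sum>i<d. 1 / (d * card S))"
    proof (intro sum_mono)
      fix i assume i: "i \<in> {..<d}"
      then have "\<bar>gs S i x\<bar> \<le> gs_norm S i / sqrt (d * card S)" using x by (simp add: gs_box_def)
      then have "(gs S i x)\<^sup>2 \<le> (gs_norm S i / sqrt (d * card S))\<^sup>2"
        by (metis abs_ge_zero power2_abs power_mono)
      also have "\<dots> = (gs_norm S i)\<^sup>2 / (d * card S)" by (simp add: power_divide)
      finally have le: "(gs S i x)\<^sup>2 \<le> (gs_norm S i)\<^sup>2 / (d * card S)" .
      have p: "(gs_norm S i)\<^sup>2 > 0" using pos[of i] i by simp
      have "(gs S i x / (gs_norm S i)\<^sup>2)\<^sup>2 * (gs_norm S i)\<^sup>2 = (gs S i x)\<^sup>2 / (gs_norm S i)\<^sup>2"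
        using pos[of i] i by (simp add: power2_eq_square)
      also have "\<dots> \<le> 1 / (d * card S)" using le p by (simp add: pos_divide_le_eq)
      finally show "(gs S i x / (gs_norm S i)\<^sup>2)\<^sup>2 * (gs_norm S i)\<^sup>2 \<le> 1 / (d * card S)" .
    qed
    also have "(\<Sum>i<d. 1 / (d * card S)) * card S \<le> 1" using S by (simp add: field_simps)
    finally have "(\<Sum>w\<in>S. \<bar>a w\<bar>)\<^sup>2 \<le> 1" using S by (simp add: mult_right_mono)
    then show ?thesis by (simp add: power_le_one_iff abs_square_le_1 sum_nonneg)
  qed
  ultimately show "x \<in> K"
    using x by (intro abs_convex_combination[OF K, of x a]) (auto simp: gs_box_def)
qed

section \<open>Compact sets: boundedness, finitely many lattice points, measurability, and the
  resulting volume bound\<close>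

lemma compactin_Rd_bounded:
  assumes "compactin (Rd_topology d) K"
  obtains B where "B > 0" "K \<subseteq> (\<Pi>\<^sub>E i\<in>{..<d}. {-B..B})"
proof -
  have "bounded ((\<lambda>x. x i) ` K)" if "i < d" for i
  proof -
    have "compactin euclideanreal ((\<lambda>x. x i) ` K)"
      using assms that unfolding Rd_topology_def
      by (intro image_compactin[OF _ continuous_map_product_projection]) auto
    then show ?thesis by (simp add: compact_imp_bounded)
  qed
  then have "bounded (\<Union>i<d. (\<lambda>x. x i) ` K)" by (intro bounded_UN) auto
  then obtain B where B: "B > 0" "\<And>t. t \<in> (\<Union>i<d. (\<lambda>x. x i) ` K) \<Longrightarrow> norm t \<le> B"
    unfolding bounded_pos by blast
  have "K \<subseteq> topspace (Rd_topology d)" using assms by (rule compactin_subset_topspace)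
  then have sub: "K \<subseteq> (\<Pi>\<^sub>E i\<in>{..<d}. UNIV)" by (simp add: Rd_topology_def)
  have "K \<subseteq> (\<Pi>\<^sub>E i\<in>{..<d}. {-B..B})"
  proof
    fix x assume x: "x \<in> K"
    have "x i \<in> {-B..B}" if "i < d" for i
    proof -
      have "norm (x i) \<le> B" using x that by (intro B(2)) blast
      then show ?thesis by (simp add: abs_le_iff)
    qed
    then show "x \<in> (\<Pi>\<^sub>E i\<in>{..<d}. {-B..B})" using subsetD[OF sub x] by (simp add: PiE_iff)
  qed
  with B(1) that show ?thesis by blast
qed

lemma finite_lattice_points:
  assumes "compactin (Rd_topology d) K"
  shows "finite (K \<inter> Zd d)"
proof -
  obtain B where B: "K \<subseteq> (\<Pi>\<^sub>E i\<in>{..<d}. {-B..B})" by (rule compactin_Rd_bounded[OF assms])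
  have "K \<inter> Zd d \<subseteq> (\<Pi>\<^sub>E i\<in>{..<d}. {k \<in> \<int>. \<bar>k\<bar> \<le> B})"
  proof
    fix x assume x: "x \<in> K \<inter> Zd d"
    then have xB: "x \<in> (\<Pi>\<^sub>E i\<in>{..<d}. {-B..B})" using B by blast
    have "x i \<in> {k \<in> \<int>. \<bar>k\<bar> \<le> B}" if "i < d" for i
    proof -
      have "x i \<in> {-B..B}" "x i \<in> \<int>" using PiE_mem[OF xB] x that by (auto simp: Zd_def)
      then show ?thesis by auto
    qed
    then show "x \<in> (\<Pi>\<^sub>E i\<in>{..<d}. {k \<in> \<int>. \<bar>k\<bar> \<le> B})"
      using xB by (simp add: PiE_iff)
  qed
  moreover have "finite (\<Pi>\<^sub>E i\<in>{..<d}. {k \<in> \<int>. \<bar>k\<bar> \<le> B})"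
    by (intro finite_PiE finite_lessThan finite_abs_int_segment)
  ultimately show ?thesis by (rule finite_subset)
qed

text \<open>In the product over all indices \<open>K\<close> is still compact, hence Borel. It is
  pulled back along the inclusion, which is measurable since the coordinates from \<open>d\<close>
  on are constantly \<open>undefined\<close>.\<close>

lemma compactin_Rd_sets:
  assumes "compactin (Rd_topology d) K"
  shows "K \<in> sets (Pi\<^sub>M {..<d} (\<lambda>_. lborel))"
proof -
  have sub: "K \<subseteq> (\<Pi>\<^sub>E i\<in>{..<d}. UNIV)"
    using compactin_subset_topspace[OF assms] by (simp add: Rd_topology_def)
  have "continuous_map (Rd_topology d) (product_topology (\<lambda>_. euclideanreal) UNIV) (\<lambda>x. x)"
    unfolding continuous_map_componentwise_UNIV
  proof
    fix i
    show "continuous_map (Rd_topology d) euclideanreal (\<lambda>x. x i)"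
    proof (cases "i < d")
      case True
      then show ?thesis unfolding Rd_topology_def by (intro continuous_map_product_projection) auto
    next
      case False
      then show ?thesis unfolding Rd_topology_def
        by (intro continuous_map_eq[OF continuous_map_const[THEN iffD2], of _ "undefined" ])
           (auto simp: PiE_iff extensional_def)
    qed
  qed
  then have "compactin (product_topology (\<lambda>_. euclideanreal) UNIV) ((\<lambda>x. x) ` K)"
    using assms by (rule image_compactin[rotated])
  then have "compact K" by (simp add: euclidean_product_topology)
  then have "K \<in> sets borel" by (intro borel_closed compact_imp_closed)
  then have K: "K \<in> sets (Pi\<^sub>M UNIV (\<lambda>_. borel :: real measure))" by (simp add: sets_PiM_equal_borel)
  have "(\<lambda>x. x) \<in> measurable (Pi\<^sub>M {..<d} (\<lambda>_. lborel :: real measure)) (Pi\<^sub>M UNIV (\<lambda>_. borel))"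
  proof (rule measurable_PiM_single')
    fix i
    show "(\<lambda>x. x i) \<in> measurable (Pi\<^sub>M {..<d} (\<lambda>_. lborel :: real measure)) borel"
    proof (cases "i < d")
      case True
      then show ?thesis using measurable_component_singleton[of i "{..<d}" "\<lambda>_. lborel :: real measure"] by simp
    next
      case False
      then have "(\<lambda>x. x i) \<in> measurable (Pi\<^sub>M {..<d} (\<lambda>_. lborel :: real measure)) borel
         \<longleftrightarrow> (\<lambda>x. undefined) \<in> measurable (Pi\<^sub>M {..<d} (\<lambda>_. lborel :: real measure)) (borel :: real measure)"
        by (intro measurable_cong) (auto simp: space_PiM PiE_iff extensional_def)
      then show ?thesis by simp
    qed
  qed auto
  from measurable_sets[OF this K] show ?thesis
    using sub by (simp add: space_PiM Int_absorb2)
qed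

lemma emeasure_compactin_Rd_finite:
  assumes "compactin (Rd_topology d) K"
  shows "emeasure (Pi\<^sub>M {..<d} (\<lambda>_. lborel)) K < \<infinity>"
proof -
  obtain B where B: "B > 0" "K \<subseteq> (\<Pi>\<^sub>E i\<in>{..<d}. {-B..B})" using compactin_Rd_bounded[OF assms] by blast
  have "emeasure (Pi\<^sub>M {..<d} (\<lambda>_. lborel)) K \<le> emeasure (Pi\<^sub>M {..<d} (\<lambda>_. lborel)) (\<Pi>\<^sub>E i\<in>{..<d}. {-B..B})"
    using B by (intro emeasure_mono sets_PiM_I_finite) auto
  also have "\<dots> = (\<Prod>i<d. emeasure lborel {-B..B})"
    by (intro lborel_product.emeasure_PiM) auto
  also have "\<dots> < \<infinity>" using B by (simp add: ennreal_power)
  finally show ?thesis .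
qed

text \<open>\<open>K\<close> contains the box of \<open>gs_box_subset\<close>. The product of norms
  obtained here later cancels against the count in the dual box.\<close>

lemma vol_ge_gs:
  assumes "compactin (Rd_topology d) K" "convex_in d K" "origin_symmetric d K"
    and S: "S \<subseteq> K" "finite S" "S \<noteq> {}"
    and pos: "\<And>i. i < d \<Longrightarrow> gs_norm S i > 0"
  shows "vol d K \<ge> (\<Prod>i<d. 2 * gs_norm S i / sqrt (d * card S))"
proof -
  define q where "q = (\<lambda>i. gs_norm S i / sqrt (d * card S))"
  have q: "q i \<ge> 0" for i by (simp add: q_def gs_norm_nonneg)
  have "(\<Prod>i<d. 2 * q i) = measure (Pi\<^sub>M {..<d} (\<lambda>_. lborel)) (gs_box S d q)"
    using q by (simp add: measure_def emeasure_gs_box prod_ennreal prod_nonneg)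
  also have "\<dots> \<le> measure (Pi\<^sub>M {..<d} (\<lambda>_. lborel)) K"
    using gs_box_subset[OF assms(2,3) S pos] sets_gs_box compactin_Rd_sets[OF assms(1)]
      emeasure_compactin_Rd_finite[OF assms(1)]
    by (intro measure_mono_fmeasurable) (auto simp: q_def fmeasurable_def)
  finally show ?thesis by (simp only: vol_def q_def times_divide_eq_right)
qed

subsection \<open>Lattice points\<close>

text \<open>The floors make the pairing integer-valued, as \<open>collision\<close> requires, and do
  nothing on \<open>Zd d\<close>.\<close>

definition zpair :: "nat \<Rightarrow> (nat \<Rightarrow> int) \<Rightarrow> (nat \<Rightarrow> real) \<Rightarrow> int" where
  "zpair d u w = (\<Sum>i<d. u i * \<lfloor>w i\<rfloor>)"

lemma real_zpair:
  assumes "w \<in> Zd d"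
  shows "real_of_int (zpair d u w) = (\<Sum>i<d. of_int (u i) * w i)"
proof -
  have "real_of_int \<lfloor>w i\<rfloor> = w i" if "i < d" for i
    using assms that by (auto simp: Zd_def PiE_iff elim!: Ints_cases)
  then show ?thesis unfolding zpair_def of_int_sum of_int_mult by (intro sum.cong) auto
qed

lemma zpair_diff: "zpair d (\<lambda>i. u i - v i) w = zpair d u w - zpair d v w"
  by (simp add: zpair_def algebra_simps sum_subtractf)

text \<open>Phrased by annihilators, so that its failure directly supplies an integer normal vector
  of a hyperplane containing \<open>S\<close>. Support in \<open>{..<d}\<close> makes the
  representing function unique.\<close>

definition lattice_spans :: "nat \<Rightarrow> (nat \<Rightarrow> real) set \<Rightarrow> bool" where
  "lattice_spans d S \<longleftrightarrow>
     (\<forall>y. (\<forall>i\<ge>d. y i = 0) \<longrightarrow> (\<forall>w\<in>S. zpair d y w = 0) \<longrightarrow> (\<forall>i. y i = 0))"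

lemma lattice_spans_eq:
  assumes "lattice_spans d S" "\<And>i. i \<ge> d \<Longrightarrow> u i = 0" "\<And>i. i \<ge> d \<Longrightarrow> v i = 0"
    "\<And>w. w \<in> S \<Longrightarrow> zpair d u w = zpair d v w"
  shows "u = v"
proof -
  have "\<forall>i. u i - v i = 0"
    using assms(1)[unfolded lattice_spans_def, rule_format, of "\<lambda>i. u i - v i"] assms(2-4)
    by (simp add: zpair_diff)
  then show ?thesis by auto
qed

lemma sum_zpair_diff_squared:
  assumes "finite S" "S \<subseteq> Zd d"
  shows "(\<Sum>w\<in>S. (real_of_int (zpair d u w - zpair d v w))\<^sup>2)
    = (\<Sum>j<d. (gs_dual S d j (of_int \<circ> u) - gs_dual S d j (of_int \<circ> v))\<^sup>2 * (gs_norm S j)\<^sup>2)"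
proof -
  have "real_of_int (zpair d u w - zpair d v w) = (\<Sum>i<d. (of_int (u i) - of_int (v i)) * w i)" if "w \<in> S" for w
    using real_zpair[of w d] that assms(2) by (auto simp: algebra_simps sum_subtractf)
  then have "(\<Sum>w\<in>S. (real_of_int (zpair d u w - zpair d v w))\<^sup>2)
      = (\<Sum>w\<in>S. (\<Sum>i<d. (of_int (u i) - of_int (v i)) * w i)\<^sup>2)"
    by simp
  also have "\<dots> = (\<Sum>j<d. (gs_dual S d j (\<lambda>i. of_int (u i) - of_int (v i)))\<^sup>2 * (gs_norm S j)\<^sup>2)"
    by (rule sum_inner_squared[OF assms(1)])
  finally show ?thesis by (simp add: gs_dual_diff comp_def)
qed

text \<open>If some Gram--Schmidt norm vanishes, the dual box may be taken arbitrarily long in that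
  direction and short in the others, which yields an integer vector orthogonal to \<open>S\<close>.\<close>
lemma gs_norm_pos:
  assumes "lattice_spans d S" "finite S" "S \<subseteq> Zd d" and k: "k < d"
  shows "gs_norm S k > 0"
proof (rule ccontr)
  assume "\<not> gs_norm S k > 0"
  then have zero: "gs_norm S k = 0" using gs_norm_nonneg[of S k] by simp
  \<comment> \<open>These sides bound each of the \<open>d\<close> summands by (1/(2d))^2, so the
    sum of squared integers is below 1 and all vanish. The added 1 covers other vanishing
    norms.\<close>
  define l where "l = (\<lambda>j. 1 / (2 * d * (gs_norm S j + 1)))"
  have l: "l j > 0" for j using k gs_norm_nonneg[of S j] by (simp add: l_def add_nonneg_pos)
  define P where "P = (\<Prod>j\<in>{..<d} - {k}. l j / 2)"
  have P: "P > 0" unfolding P_def using l by (intro prod_pos) auto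
  \<comment> \<open>The value \<open>4 / P\<close> brings the guaranteed count to exactly 2.\<close>
  define L where "L = l(k := 4 / P)"
  have L: "L j > 0" for j using l P by (simp add: L_def)
  obtain U :: "(nat \<Rightarrow> int) set" where U: "finite U" "U \<noteq> {}" "\<And>u i. u \<in> U \<Longrightarrow> i \<ge> d \<Longrightarrow> u i = 0"
    "\<And>u v j. u \<in> U \<Longrightarrow> v \<in> U \<Longrightarrow> j < d \<Longrightarrow>
       \<bar>gs_dual S d j (of_int \<circ> u) - gs_dual S d j (of_int \<circ> v)\<bar> \<le> L j"
    "card U \<ge> (\<Prod>j<d. L j / 2)"
    by (rule dense_integer_box[where S = S and d = d and L = L]) (use L in auto)
  have "(\<Prod>j<d. L j / 2) = L k / 2 * (\<Prod>j\<in>{..<d} - {k}. L j / 2)"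
    using k by (intro prod.remove) auto
  also have "(\<Prod>j\<in>{..<d} - {k}. L j / 2) = P" unfolding P_def L_def by (intro prod.cong) auto
  finally have "card U \<ge> 2" using U(5) P by (simp add: L_def)
  then obtain u v where uv: "u \<in> U" "v \<in> U" "u \<noteq> v"
    by (metis card_le_Suc0_iff_eq U(1) not_less_eq_eq numeral_2_eq_2)
  have "(\<Sum>w\<in>S. (real_of_int (zpair d u w - zpair d v w))\<^sup>2) \<le> (\<Sum>j<d. (1 / (2 * d))\<^sup>2)"
    unfolding sum_zpair_diff_squared[OF assms(2,3)]
  proof (intro sum_mono)
    fix j assume j: "j \<in> {..<d}"
    show "(gs_dual S d j (of_int \<circ> u) - gs_dual S d j (of_int \<circ> v))\<^sup>2 * (gs_norm S j)\<^sup>2 \<le> (1 / (2 * d))\<^sup>2"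
    proof (cases "j = k")
      case False
      have "\<bar>gs_dual S d j (of_int \<circ> u) - gs_dual S d j (of_int \<circ> v)\<bar> * gs_norm S j \<le> l j * gs_norm S j"
        using U(4)[OF uv(1,2), of j] j False gs_norm_nonneg[of S j]
        by (intro mult_right_mono) (auto simp: L_def)
      also have "\<dots> = 1 / (2 * d) * (gs_norm S j / (gs_norm S j + 1))" by (simp add: l_def)
      also have "\<dots> \<le> 1 / (2 * d)"
        using gs_norm_nonneg[of S j] by (intro mult_left_le) (auto simp: pos_divide_le_eq)
      finally have "(\<bar>gs_dual S d j (of_int \<circ> u) - gs_dual S d j (of_int \<circ> v)\<bar> * gs_norm S j)\<^sup>2 \<le> (1 / (2 * d))\<^sup>2"
        using gs_norm_nonneg[of S j] by (intro power_mono) auto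
      then show ?thesis by (simp add: power_mult_distrib)
    qed (use zero in simp)
  qed
  also have "\<dots> = 1 / (4 * d)" using k by (simp add: power2_eq_square)
  also have "\<dots> < 1" using k by simp
  finally have small: "(\<Sum>w\<in>S. (real_of_int (zpair d u w - zpair d v w))\<^sup>2) < 1" .
  have "zpair d u w = zpair d v w" if "w \<in> S" for w
  proof -
    have "(real_of_int (zpair d u w - zpair d v w))\<^sup>2 < 1"
      using member_le_sum[of w S "\<lambda>w. (real_of_int (zpair d u w - zpair d v w))\<^sup>2"] that assms(2) small
      by simp
    then have "\<bar>real_of_int (zpair d u w - zpair d v w)\<bar> < 1" by (simp add: abs_square_less_1)
    then show ?thesis by linarith
  qed
  then have "u = v" using U(3) uv by (intro lattice_spans_eq[OF assms(1)])
  with uv show False by simp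
qed

text \<open>Take dual sides inversely proportional to the norms: the lower bounds for
  \<open>card U\<close> and for \<open>vol d K\<close> then multiply to an expression free of the
  norms.\<close>

lemma many_short_functionals:
  fixes r :: real
  assumes K: "compactin (Rd_topology d) K" "convex_in d K" "origin_symmetric d K"
    and S: "finite S" "S \<subseteq> K" "S \<subseteq> Zd d" "S \<noteq> {}" "lattice_spans d S"
    and "d > 0" "r > 0"
  obtains U :: "(nat \<Rightarrow> int) set" where "finite U" "U \<noteq> {}"
    "\<And>u i. u \<in> U \<Longrightarrow> i \<ge> d \<Longrightarrow> u i = 0"
    "\<And>u v. u \<in> U \<Longrightarrow> v \<in> U \<Longrightarrow>
       (\<Sum>w\<in>S. (real_of_int (zpair d u w - zpair d v w))\<^sup>2) \<le> card S * r\<^sup>2"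
    "card U * vol d K \<ge> (r / d) ^ d"
proof -
  have pos: "gs_norm S j > 0" if "j < d" for j
    using gs_norm_pos[OF S(5,1,3)] that by blast
  define n where "n = real (card S)"
  have n: "n > 0" using S by (simp add: n_def card_gt_0_iff)
  \<comment> \<open>Chosen so that \<open>d\<close> summands of size \<open>s\<^sup>2\<close> add up
    to \<open>card S * r\<^sup>2\<close>.\<close>
  define s where "s = r * sqrt (n / d)"
  have s: "s > 0" using n assms by (simp add: s_def)
  obtain U :: "(nat \<Rightarrow> int) set" where U: "finite U" "U \<noteq> {}" "\<And>u i. u \<in> U \<Longrightarrow> i \<ge> d \<Longrightarrow> u i = 0"
    "\<And>u v j. u \<in> U \<Longrightarrow> v \<in> U \<Longrightarrow> j < d \<Longrightarrow>
       \<bar>gs_dual S d j (of_int \<circ> u) - gs_dual S d j (of_int \<circ> v)\<bar> \<le> s / gs_norm S j"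
    "card U \<ge> (\<Prod>j<d. s / gs_norm S j / 2)"
    by (rule dense_integer_box[where S = S and d = d and L = "\<lambda>j. s / gs_norm S j"]) (use s pos in auto)
  have close: "(\<Sum>w\<in>S. (real_of_int (zpair d u w - zpair d v w))\<^sup>2) \<le> card S * r\<^sup>2"
    if "u \<in> U" "v \<in> U" for u v
  proof -
    have "(\<Sum>w\<in>S. (real_of_int (zpair d u w - zpair d v w))\<^sup>2) \<le> (\<Sum>j<d. s\<^sup>2)"
      unfolding sum_zpair_diff_squared[OF S(1,3)]
    proof (intro sum_mono)
      fix j assume j: "j \<in> {..<d}"
      have "\<bar>gs_dual S d j (of_int \<circ> u) - gs_dual S d j (of_int \<circ> v)\<bar> * gs_norm S j \<le> s"
        using U(4)[OF that, of j] j pos[of j] by (simp add: pos_le_divide_eq)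
      then have "(\<bar>gs_dual S d j (of_int \<circ> u) - gs_dual S d j (of_int \<circ> v)\<bar> * gs_norm S j)\<^sup>2 \<le> s\<^sup>2"
        using gs_norm_nonneg[of S j] by (intro power_mono) auto
      then show "(gs_dual S d j (of_int \<circ> u) - gs_dual S d j (of_int \<circ> v))\<^sup>2 * (gs_norm S j)\<^sup>2 \<le> s\<^sup>2"
        by (simp add: power_mult_distrib)
    qed
    also have "\<dots> = card S * r\<^sup>2"
      using \<open>d > 0\<close> n by (simp add: s_def power_mult_distrib n_def)
    finally show ?thesis .
  qed
  have "(r / d) ^ d = (\<Prod>j<d. s / gs_norm S j / 2 * (2 * gs_norm S j / sqrt (d * card S)))"
  proof -
    have "s / gs_norm S j / 2 * (2 * gs_norm S j / sqrt (d * card S)) = r / d" if "j < d" for j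
    proof -
      have "s / gs_norm S j / 2 * (2 * gs_norm S j / sqrt (d * card S)) = s / sqrt (d * n)"
        using pos[OF that] by (simp add: n_def)
      also have "\<dots> = r / d"
        using n \<open>d > 0\<close> by (simp add: s_def real_sqrt_mult real_sqrt_divide)
      finally show ?thesis .
    qed
    then show ?thesis by simp
  qed
  also have "\<dots> = (\<Prod>j<d. s / gs_norm S j / 2) * (\<Prod>j<d. 2 * gs_norm S j / sqrt (d * card S))"
    by (rule prod.distrib)
  also have "\<dots> \<le> card U * vol d K"
    using U(5) vol_ge_gs[OF K S(2,1,4) pos] gs_norm_nonneg
    by (intro mult_mono prod_nonneg) auto
  finally have "card U * vol d K \<ge> (r / d) ^ d" .
  with that[of U] U(1-3) close show ?thesis by simp
qed

text \<open>The map sending \<open>u\<close> to its values on at most \<open>d\<close> lattice points of \<open>K\<close> is injective,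
  and its image lies in a ball of radius \<open>\<surd>d\<close>, which has only exponentially many integer points.\<close>
lemma vol_ge_of_lattice_spans:
  assumes K: "compactin (Rd_topology d) K" "convex_in d K" "origin_symmetric d K"
    and spans: "lattice_spans d (K \<inter> Zd d)" and "d > 0"
  shows "vol d K \<ge> 1 / (6 * real d) ^ d"
proof -
  \<comment> \<open>At most \<open>d\<close> points are kept so that the vectors of values live in
    dimension at most \<open>d\<close>, which makes their number exponential in
    \<open>d\<close>.\<close>
  obtain B where B: "B \<subseteq> K \<inter> Zd d" "finite B" "card B \<le> d"
    "\<And>y. (\<forall>w\<in>B. (\<Sum>i<d. y i * w i) = 0) \<Longrightarrow> (\<forall>w\<in>K \<inter> Zd d. (\<Sum>i<d. y i * w i) = 0)"
    by (rule card_le_dim_determining[of "K \<inter> Zd d" d]) (rule that; assumption)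
  have spansB: "lattice_spans d B"
    unfolding lattice_spans_def
  proof (intro allI impI)
    fix y :: "nat \<Rightarrow> int" and i assume y: "\<forall>i\<ge>d. y i = 0" "\<forall>w\<in>B. zpair d y w = 0"
    then have "\<forall>w\<in>B. (\<Sum>i<d. real_of_int (y i) * w i) = 0"
      using B(1) by (auto simp: real_zpair[symmetric])
    then have "\<forall>w\<in>K \<inter> Zd d. (\<Sum>i<d. real_of_int (y i) * w i) = 0" by (rule B(4))
    then have "\<forall>w\<in>K \<inter> Zd d. zpair d y w = 0" by (auto simp flip: real_zpair)
    then show "y i = 0" using spans y(1) unfolding lattice_spans_def by blast
  qed
  have "B \<noteq> {}"
  proof
    assume "B = {}"
    then have "(\<lambda>i::nat. if i = 0 then 1 else 0 :: int) = (\<lambda>_. 0)"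
      using \<open>d > 0\<close> by (intro lattice_spans_eq[OF spansB]) auto
    from fun_cong[OF this, of 0] show False by simp
  qed
  obtain U :: "(nat \<Rightarrow> int) set" where U: "finite U" "U \<noteq> {}" "\<And>u i. u \<in> U \<Longrightarrow> i \<ge> d \<Longrightarrow> u i = 0"
    "\<And>u v. u \<in> U \<Longrightarrow> v \<in> U \<Longrightarrow>
       (\<Sum>w\<in>B. (real_of_int (zpair d u w - zpair d v w))\<^sup>2) \<le> card B * 1\<^sup>2"
    "card U * vol d K \<ge> (1 / d) ^ d"
    by (rule many_short_functionals[OF K B(2) _ _ \<open>B \<noteq> {}\<close> spansB \<open>d > 0\<close>, of 1]) (use B(1) in auto)
  obtain v where v: "v \<in> U" using U(2) by blast
  \<comment> \<open>Subtracting the values of a fixed \<open>v\<close> centres the image in the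
    ball; the bound for radius 1 gives a squared length of at most
    \<open>card B \<le> d\<close>.\<close>
  define z where "z = (\<lambda>u. \<lambda>w\<in>B. zpair d u w - zpair d v w)"
  have "inj_on z U"
  proof (rule inj_onI)
    fix u u' assume "u \<in> U" "u' \<in> U" and eq: "z u = z u'"
    have "zpair d u w = zpair d u' w" if "w \<in> B" for w
      using fun_cong[OF eq, of w] that by (simp add: z_def)
    then show "u = u'" using U(3) \<open>u \<in> U\<close> \<open>u' \<in> U\<close> by (intro lattice_spans_eq[OF spansB])
  qed
  have "card (z ` U) \<le> 6 ^ d"
  proof (rule card_int_ball_le[OF _ _ B(2,3)])
    fix x assume "x \<in> z ` U"
    then obtain u where u: "u \<in> U" "x = z u" by blast
    have "real_of_int (\<Sum>w\<in>B. (x w)\<^sup>2) = (\<Sum>w\<in>B. (real_of_int (zpair d u w - zpair d v w))\<^sup>2)"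
      using u by (simp add: z_def)
    also have "\<dots> \<le> d" using U(4)[OF u(1) v] B(3) by simp
    finally have "(\<Sum>w\<in>B. (x w)\<^sup>2) \<le> int d" by linarith
    then show "x \<in> (\<Pi>\<^sub>E i\<in>B. UNIV) \<and> (\<Sum>w\<in>B. (x w)\<^sup>2) \<le> int d"
      using u by (auto simp: z_def)
  qed (use U in auto)
  then have "card U \<le> 6 ^ d" using \<open>inj_on z U\<close> by (simp add: card_image)
  then have "real (card U) \<le> 6 ^ d" by (metis of_nat_le_iff of_nat_numeral of_nat_power)
  moreover have "vol d K \<ge> 0" by (simp add: vol_def)
  ultimately have "(1 / d) ^ d \<le> 6 ^ d * vol d K"
    using U(5) mult_right_mono[of "real (card U)" "6 ^ d" "vol d K"] by linarith
  then show ?thesis using \<open>d > 0\<close> by (simp add: field_simps power_mult_distrib)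
qed

section \<open>Choice of the radius and conclusion\<close>

theorem theorem3p1:
  "\<exists>c::real. c > 0 \<and>
     (\<forall>d::nat. d \<ge> 2 \<longrightarrow>
       (\<forall>K :: (nat \<Rightarrow> real) set. convex_body d K \<and> origin_symmetric d K \<longrightarrow>
         (\<exists>y \<in> Zd d. y \<noteq> zero_vector d \<and>
            real (card (K \<inter> Zd d \<inter> perp d y)) / real (card (K \<inter> Zd d))
              \<ge> min 1 (c * (1 / real d) * vol d K powr (- 1 / (real d - 1))))))"
proof (intro exI[of _ "1/1440"] conjI allI impI)
  fix d :: nat and K :: "(nat \<Rightarrow> real) set"
  assume d: "d \<ge> 2" and body: "convex_body d K \<and> origin_symmetric d K"
  then have K: "compactin (Rd_topology d) K" "convex_in d K" "origin_symmetric d K" and "K \<noteq> {}"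
    by (auto simp: convex_body_def)
  define A where "A = K \<inter> Zd d"
  have A: "finite A" unfolding A_def by (rule finite_lattice_points[OF K(1)])
  obtain k where "k \<in> K" using \<open>K \<noteq> {}\<close> by blast
  have "zero_vector d \<in> K"
    by (rule abs_convex_combination[OF K(2,3), of "{k}" _ "\<lambda>_. 0"]) (use \<open>k \<in> K\<close> in \<open>auto simp: zero_vector_def Rd_def\<close>)
  then have "zero_vector d \<in> A" by (auto simp: A_def Zd_def zero_vector_def)
  then have "A \<noteq> {}" by blast
  define V where "V = vol d K"
  let ?good = "\<lambda>y. y \<in> Zd d \<and> y \<noteq> zero_vector d \<and>
    real (card (A \<inter> perp d y)) / real (card A) \<ge> min 1 (1/1440 * (1 / real d) * V powr (- 1 / (real d - 1)))"
  define vec where "vec = (\<lambda>y :: nat \<Rightarrow> int. \<lambda>i\<in>{..<d}. real_of_int (y i))"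
  have vec_Zd: "vec y \<in> Zd d" for y by (auto simp: vec_def Zd_def)
  have vec_nz: "vec y \<noteq> zero_vector d" if "\<And>i. i \<ge> d \<Longrightarrow> y i = 0" "y i \<noteq> 0" for y i
  proof
    assume eq: "vec y = zero_vector d"
    have "i < d" using that by (metis not_less)
    with fun_cong[OF eq, of i] that show False by (simp add: vec_def zero_vector_def)
  qed
  have vec_perp: "A \<inter> perp d (vec y) = {w \<in> A. zpair d y w = 0}" for y
  proof -
    have "(\<Sum>i<d. w i * vec y i) = real_of_int (zpair d y w)" if "w \<in> A" for w
      using real_zpair[of w d y] that by (simp add: A_def vec_def mult.commute)
    moreover have "A \<subseteq> Rd d" by (auto simp: A_def Zd_def Rd_def PiE_iff)
    ultimately show ?thesis by (auto simp: perp_def)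
  qed
  have "\<exists>y. ?good y"
  proof (cases "lattice_spans d A")
    \<comment> \<open>All lattice points lie in one hyperplane with an integer normal, so the ratio
      is 1.\<close>
    case False
    then obtain y i where y: "\<And>i. i \<ge> d \<Longrightarrow> y i = 0" "\<And>w. w \<in> A \<Longrightarrow> zpair d y w = 0" "y i \<noteq> 0"
      unfolding lattice_spans_def by blast
    have "A \<inter> perp d (vec y) = A" using vec_perp y(2) by auto
    then show ?thesis
      using vec_Zd[of y] vec_nz[of y i] y(1,3) A \<open>A \<noteq> {}\<close> by (intro exI[of _ "vec y"]) auto
  next
    case True
    define a where "a = V powr (- 1 / (real d - 1))"
    \<comment> \<open>\<open>collision\<close> yields the ratio \<open>1 / (20 * r)\<close>, hence
      1440 = 20 * 72. The factor 72 = 6 * 12 cancels the 6 in \<open>V_low\<close> and leaves 12^m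
      to absorb \<open>6 * d\<close>.\<close>
    define r where "r = 72 * d / a"
    have V_low: "V \<ge> 1 / (6 * real d) ^ d"
      using vol_ge_of_lattice_spans[OF K] True d by (simp add: V_def A_def)
    moreover have "1 / (6 * real d) ^ d > 0" using d by simp
    ultimately have V: "V > 0" by linarith
    have a: "a > 0" using V by (simp add: a_def)
    then have r0: "r > 0" using d by (simp add: r_def)
    obtain m where m: "d = Suc m" "m \<ge> 1" using d by (metis Suc_le_D Suc_le_mono numeral_2_eq_2 One_nat_def)
    have "a ^ m = 1 / V"
    proof -
      have "a ^ m = V powr (- 1 / real m * real m)"
        using V m by (simp add: a_def powr_realpow[symmetric] powr_powr)
      then show ?thesis using V m by (simp add: powr_minus_divide)
    qed
    then have r_pow: "r ^ m = 72 ^ m * real d ^ m * V"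
      by (simp add: r_def power_divide power_mult_distrib)
    have growth: "12 ^ m \<ge> 6 * (real m + 1)" "72 ^ m \<ge> 20 * (real m + 1)"
      using m(2) by (induction m rule: dec_induct) auto
    have "r ^ m \<ge> 1"
    proof -
      have "1 \<le> 12 ^ m / (6 * real d)" using growth m by simp
      also have "\<dots> = 72 ^ m * real d ^ m * (1 / (6 * real d) ^ d)"
      proof -
        have "(72::real) ^ m = 12 ^ m * 6 ^ m" by (simp flip: power_mult_distrib)
        then show ?thesis using m(1) by (simp add: power_mult_distrib del: of_nat_Suc)
      qed
      also have "\<dots> \<le> r ^ m" unfolding r_pow using V_low by (intro mult_left_mono) auto
      finally show ?thesis .
    qed
    have r: "r \<ge> 1"
    proof (rule ccontr)
      assume "\<not> r \<ge> 1"
      then have "r ^ m < 1" using r0 m by (simp add: power_less_one_iff)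
      with \<open>r ^ m \<ge> 1\<close> show False by simp
    qed
    obtain U :: "(nat \<Rightarrow> int) set" where U: "finite U" "\<And>u i. u \<in> U \<Longrightarrow> i \<ge> d \<Longrightarrow> u i = 0"
      "\<And>u v. u \<in> U \<Longrightarrow> v \<in> U \<Longrightarrow>
         (\<Sum>w\<in>A. (real_of_int (zpair d u w - zpair d v w))\<^sup>2) \<le> card A * r\<^sup>2"
      "card U * V \<ge> (r / d) ^ d"
      by (rule many_short_functionals[OF K A _ _ \<open>A \<noteq> {}\<close> True _ r0]) (use d in \<open>auto simp: A_def V_def\<close>)
    \<comment> \<open>Of the \<open>d = m + 1\<close> factors of \<open>r\<close> in
      \<open>(r / d) ^ d\<close>, \<open>m\<close> produce \<open>V\<close> through
      \<open>r_pow\<close> and one remains. Dividing by \<open>V\<close> leaves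
      \<open>card U\<close> at least r * 72^m / d, hence at least 20 r.\<close>
    have "20 \<le> 72 ^ m / real d" using growth(2) m by (simp add: pos_le_divide_eq)
    then have "r * 20 * V \<le> r * (72 ^ m / d) * V"
      using r0 V by (intro mult_right_mono mult_left_mono) auto
    also have "\<dots> = (r / d) ^ d"
      using r_pow m(1) by (simp add: power_divide del: of_nat_Suc)
    also have "\<dots> \<le> card U * V" by (rule U(4))
    finally have card_U: "card U \<ge> 20 * r" using V by (simp add: mult.commute)
    obtain u v where uv: "u \<in> U" "v \<in> U" "u \<noteq> v"
      "card {w\<in>A. zpair d u w = zpair d v w} \<ge> card A / (20 * r)"
      by (rule collision[where X = "zpair d", OF A \<open>A \<noteq> {}\<close> U(1) r U(3) card_U])
    define y where "y = (\<lambda>i. u i - v i)"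
    obtain i where "u i \<noteq> v i" using uv(3) by auto
    then have "vec y \<noteq> zero_vector d"
      using U(2)[OF uv(1)] U(2)[OF uv(2)] by (intro vec_nz[of y i]) (simp_all add: y_def)
    moreover have "A \<inter> perp d (vec y) = {w\<in>A. zpair d u w = zpair d v w}"
      unfolding vec_perp by (simp add: y_def zpair_diff)
    moreover have "real (card {w\<in>A. zpair d u w = zpair d v w}) / card A \<ge> 1 / (20 * r)"
      using uv(4) A \<open>A \<noteq> {}\<close> r0 by (simp add: field_simps card_gt_0_iff)
    moreover have "1 / (20 * r) = 1/1440 * (1 / real d) * a" by (simp add: r_def)
    ultimately show ?thesis using vec_Zd[of y] by (intro exI[of _ "vec y"]) (auto simp: a_def)
  qed
  then show "\<exists>y\<in>Zd d. y \<noteq> zero_vector d \<and>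
      real (card (K \<inter> Zd d \<inter> perp d y)) / real (card (K \<inter> Zd d))
        \<ge> min 1 (1/1440 * (1 / real d) * vol d K powr (- 1 / (real d - 1)))"
    by (auto simp: A_def V_def)
qed simp

end
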